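(* Let $\mathbb G$ be a Carnot group of step two with left-invariant sub-Laplacian $\Delta_{\mathcal H}=\sum_{i=1}^nX_i^2$, let $D=\sum_{i=1}^nx_iX_i+2\sum_{k=1}^mz_kZ_k$ be the generator of the dilation group $(\delta_{e^s})_{s\in\mathbb R}$, and let $L=\Delta_{\mathcal H}-D$. Set $$\kappa=\sup_{\|x\|=1}\sum_{j=1}^n\sum_{k=1}^m\Big(\sum_{i=1}^n\gamma_{ij}^kx_i\Big)^2,\qquad \rho_2=\frac14\inf_{\|z\|=1}\sum_{i,j=1}^n\Big(\sum_{k=1}^m\gamma_{ij}^kz_k\Big)^2 .$$ Then for every $f\in C^\infty(\mathbb G)$ and $\varepsilon>0$, $$\Gamma_2(f,f)+\varepsilon\,\Gamma_2^Z(f,f)\ge\Big(1-\frac{\kappa}{\varepsilon}\Big)\Gamma(f,f)+(2\varepsilon+\rho_2)\,\Gamma^Z(f,f).$$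
   Context: A Carnot group of step two is a simply connected Lie group $\mathbb G$ whose Lie algebra is $\mathfrak g=V_1\oplus V_2$ with $[V_1,V_1]=V_2$ and $[V_1,V_2]=\{0\}$. Let $e_1,\dots,e_n$ and $\varepsilon_1,\dots,\varepsilon_m$ be orthonormal bases of $V_1$ and $V_2$, let $X_1,\dots,X_n$ and $Z_1,\dots,Z_m$ be the corresponding left-invariant vector fields, and let $\gamma_{ij}^k=\langle[e_i,e_j],\varepsilon_k\rangle$. In exponential coordinates $(x,z)\in\mathbb R^n\times\mathbb R^m$, $Z_k=\partial_{z_k}$ and $X_i=\partial_{x_i}-\frac12\sum_{k=1}^m\sum_{j=1}^n\gamma_{ij}^kx_jZ_k$, with $[X_i,X_j]=\sum_k\gamma_{ij}^kZ_k$. The dilations on $\mathfrak g$ are $\delta_t=$ multiplication by $t^i$ on $V_i$, transferred to $\mathbb G$ by $\delta_t(\exp Z)=\exp\delta_t(Z)$. $\Gamma$ and $\Gamma^Z$ are the symmetric bilinear forms with $\Gamma(f,f)=\sum_{i=1}^n(X_if)^2$ and $\Gamma^Z(f,f)=\sum_{k=1}^m(Z_kf)^2$. Their iterations with respect to $L$ are $\Gamma_2(f,f)=\frac12(L\Gamma(f,f)-2\Gamma(f,Lf))$ and $\Gamma_2^Z(f,f)=\frac12(L\Gamma^Z(f,f)-2\Gamma^Z(f,Lf))$. *)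

theory Defs
  imports "HOL-Analysis.Analysis" "HOL-Algebra.Group"
begin

section \<open>Smooth functions on a Euclidean space\<close>

primrec Ck :: "nat \<Rightarrow> ('a::real_normed_vector \<Rightarrow> 'b::real_normed_vector) \<Rightarrow> bool" where
  "Ck 0 F \<longleftrightarrow> continuous_on UNIV F"
| "Ck (Suc k) F \<longleftrightarrow>
     (\<forall>x. F differentiable (at x)) \<and> (\<forall>v. Ck k (\<lambda>x. frechet_derivative F (at x) v))"

definition smooth :: "('a::euclidean_space \<Rightarrow> 'b::real_normed_vector) \<Rightarrow> bool" where
  "smooth F \<longleftrightarrow> (\<forall>k. Ck k F)"


section \<open>Carnot groups of step two\<close>

definition lie_bracket :: "('g::real_vector \<Rightarrow> 'g \<Rightarrow> 'g) \<Rightarrow> bool" where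
  "lie_bracket br \<longleftrightarrow> bilinear br \<and> (\<forall>v. br v v = 0) \<and>
     (\<forall>u v w. br u (br v w) + br v (br w u) + br w (br u v) = 0)"

definition step_two_stratification ::
    "('g::real_vector \<Rightarrow> 'g \<Rightarrow> 'g) \<Rightarrow> 'g set \<Rightarrow> 'g set \<Rightarrow> bool" where
  "step_two_stratification br V1 V2 \<longleftrightarrow>
     subspace V1 \<and> subspace V2 \<and> V1 \<inter> V2 = {0} \<and> {v + w |v w. v \<in> V1 \<and> w \<in> V2} = UNIV \<and>
     V2 \<noteq> {0} \<and>
     span {br v w |v w. v \<in> V1 \<and> w \<in> V1} = V2 \<and> {br v w |v w. v \<in> V1 \<and> w \<in> V2} = {0}"

text \<open>A simply connected Lie group with two-step nilpotent Lie algebra is presented by its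
  exponential map: \<open>Exp\<close> is a bijection from the Lie algebra onto the group, the smooth structure
  of the group is the one carried over by \<open>Exp\<close> (see \<open>smooth_fun\<close> below), and the group law is
  given by the Baker-Campbell-Hausdorff formula, which stops after the first bracket.\<close>

definition carnot_group_step_two ::
    "('p, 'q) monoid_scheme \<Rightarrow> ('g::euclidean_space \<Rightarrow> 'p) \<Rightarrow> ('g \<Rightarrow> 'g \<Rightarrow> 'g) \<Rightarrow>
     'g set \<Rightarrow> 'g set \<Rightarrow> bool" where
  "carnot_group_step_two G Exp br V1 V2 \<longleftrightarrow>
     group G \<and> lie_bracket br \<and> step_two_stratification br V1 V2 \<and>
     bij_betw Exp UNIV (carrier G) \<and>
     (\<forall>v w. Exp v \<otimes>\<^bsub>G\<^esub> Exp w = Exp (v + w + (1/2) *\<^sub>R br v w))"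

definition smooth_fun :: "('g::euclidean_space \<Rightarrow> 'p) \<Rightarrow> ('p \<Rightarrow> real) \<Rightarrow> bool" where
  "smooth_fun Exp f \<longleftrightarrow> smooth (\<lambda>v. f (Exp v))"

text \<open>The inner product of \<open>'g\<close> matters only on \<open>V1\<close> and on \<open>V2\<close> separately; the two layers are
  not required to be orthogonal to each other.\<close>

definition orthonormal_basis :: "('i \<Rightarrow> 'g::euclidean_space) \<Rightarrow> 'g set \<Rightarrow> bool" where
  "orthonormal_basis b V \<longleftrightarrow>
     (\<forall>i j. b i \<bullet> b j = (if i = j then 1 else 0)) \<and> span (range b) = V"

definition structure_constant ::
    "('g::euclidean_space \<Rightarrow> 'g \<Rightarrow> 'g) \<Rightarrow> ('n \<Rightarrow> 'g) \<Rightarrow> ('m \<Rightarrow> 'g) \<Rightarrow> 'n \<Rightarrow> 'n \<Rightarrow> 'm \<Rightarrow> real" where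
  "structure_constant br e u i j k = br (e i) (e j) \<bullet> u k"

definition left_inv_field ::
    "('p, 'q) monoid_scheme \<Rightarrow> ('g::real_vector \<Rightarrow> 'p) \<Rightarrow> 'g \<Rightarrow> ('p \<Rightarrow> real) \<Rightarrow> 'p \<Rightarrow> real" where
  "left_inv_field G Exp v f p = deriv (\<lambda>t. f (p \<otimes>\<^bsub>G\<^esub> Exp (t *\<^sub>R v))) 0"

definition exp_coord ::
    "('g::real_vector \<Rightarrow> 'p) \<Rightarrow> ('n \<Rightarrow> 'g) \<Rightarrow> ('m \<Rightarrow> 'g) \<Rightarrow> 'g \<Rightarrow> 'p \<Rightarrow> real" where
  "exp_coord Exp e u b p = representation (range e \<union> range u) (inv_into UNIV Exp p) b"

definition sub_laplacian ::
    "('p, 'q) monoid_scheme \<Rightarrow> ('g::real_vector \<Rightarrow> 'p) \<Rightarrow> ('n::finite \<Rightarrow> 'g) \<Rightarrow>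
     ('p \<Rightarrow> real) \<Rightarrow> 'p \<Rightarrow> real" where
  "sub_laplacian G Exp e f p =
     (\<Sum>i\<in>UNIV. left_inv_field G Exp (e i) (left_inv_field G Exp (e i) f) p)"

definition dilation_field ::
    "('p, 'q) monoid_scheme \<Rightarrow> ('g::real_vector \<Rightarrow> 'p) \<Rightarrow> ('n::finite \<Rightarrow> 'g) \<Rightarrow> ('m::finite \<Rightarrow> 'g) \<Rightarrow>
     ('p \<Rightarrow> real) \<Rightarrow> 'p \<Rightarrow> real" where
  "dilation_field G Exp e u f p =
     (\<Sum>i\<in>UNIV. exp_coord Exp e u (e i) p * left_inv_field G Exp (e i) f p) +
     2 * (\<Sum>k\<in>UNIV. exp_coord Exp e u (u k) p * left_inv_field G Exp (u k) f p)"

definition kappa :: "('n::finite \<Rightarrow> 'n \<Rightarrow> 'm::finite \<Rightarrow> real) \<Rightarrow> real" where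
  "kappa \<gamma> = (SUP x\<in>{x::real^'n. norm x = 1}.
     \<Sum>j\<in>UNIV. \<Sum>k\<in>UNIV. (\<Sum>i\<in>UNIV. \<gamma> i j k * x $ i)\<^sup>2)"

definition rho2 :: "('n::finite \<Rightarrow> 'n \<Rightarrow> 'm::finite \<Rightarrow> real) \<Rightarrow> real" where
  "rho2 \<gamma> = 1/4 * (INF z\<in>{z::real^'m. norm z = 1}.
     \<Sum>i\<in>UNIV. \<Sum>j\<in>UNIV. (\<Sum>k\<in>UNIV. \<gamma> i j k * z $ k)\<^sup>2)"


section \<open>Gradient forms and their iterations\<close>

definition gradient_form ::
    "('i::finite \<Rightarrow> ('p \<Rightarrow> real) \<Rightarrow> 'p \<Rightarrow> real) \<Rightarrow> ('p \<Rightarrow> real) \<Rightarrow> ('p \<Rightarrow> real) \<Rightarrow> 'p \<Rightarrow> real" where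
  "gradient_form Y f h p = (\<Sum>i\<in>UNIV. Y i f p * Y i h p)"

text \<open>The quadratic form \<open>f \<mapsto> (L Q(f,f) - 2 Q(f, L f)) / 2\<close> of the iteration of the symmetric
  bilinear form \<open>Q\<close>.\<close>

definition iterated_form ::
    "(('p \<Rightarrow> real) \<Rightarrow> 'p \<Rightarrow> real) \<Rightarrow> (('p \<Rightarrow> real) \<Rightarrow> ('p \<Rightarrow> real) \<Rightarrow> 'p \<Rightarrow> real) \<Rightarrow>
     ('p \<Rightarrow> real) \<Rightarrow> 'p \<Rightarrow> real" where
  "iterated_form L Q f p = 1/2 * (L (Q f f) p - 2 * Q f (L f) p)"


section \<open>Exponential coordinates and the generator of the dilations\<close>

text \<open>Nothing below enters the other definitions. It confirms that the left-invariant fields have the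
  usual expression in exponential coordinates (\<open>left_inv_field_coordinates\<close>) and that
  \<open>dilation_field\<close> generates the dilation group (\<open>dilation_field_generates\<close>).\<close>

definition dilation ::
    "('g::real_vector \<Rightarrow> 'p) \<Rightarrow> 'g set \<Rightarrow> 'g set \<Rightarrow> real \<Rightarrow> 'p \<Rightarrow> 'p" where
  "dilation Exp V1 V2 t p =
     Exp (THE y. \<exists>v\<in>V1. \<exists>w\<in>V2. inv_into UNIV Exp p = v + w \<and> y = t *\<^sub>R v + t\<^sup>2 *\<^sub>R w)"

lemma left_inv_field_Exp:
  assumes C: "carnot_group_step_two G Exp br V1 V2" and f: "smooth_fun Exp f"
  shows "left_inv_field G Exp v f (Exp w) =
    frechet_derivative (\<lambda>v. f (Exp v)) (at w) (v + (1/2) *\<^sub>R br w v)"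
proof -
  let ?F = "\<lambda>v. f (Exp v)" and ?d = "v + (1/2) *\<^sub>R br w v"
  have "Ck (Suc 0) ?F" using f unfolding smooth_fun_def smooth_def by blast
  then have "(?F has_derivative frechet_derivative ?F (at w)) (at w)"
    by (simp add: frechet_derivative_works)
  then have F: "(?F has_derivative frechet_derivative ?F (at w)) (at (w + 0 *\<^sub>R ?d))" by simp
  have bl: "bilinear br" using C by (simp add: carnot_group_step_two_def lie_bracket_def)
  have "((\<lambda>t::real. w + t *\<^sub>R ?d) has_derivative (\<lambda>t. t *\<^sub>R ?d)) (at 0)"
    by (auto intro!: derivative_eq_intros)
  from has_derivative_compose[OF this F]
  have "((\<lambda>t. ?F (w + t *\<^sub>R ?d)) has_derivative (\<lambda>t. frechet_derivative ?F (at w) (t *\<^sub>R ?d))) (at 0)" .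
  moreover have "frechet_derivative ?F (at w) (t *\<^sub>R ?d) = frechet_derivative ?F (at w) ?d * t" for t
    using has_derivative_linear[OF F] by (simp add: linear_cmul del: scaleR_add_right)
  moreover have "f (Exp w \<otimes>\<^bsub>G\<^esub> Exp (t *\<^sub>R v)) = ?F (w + t *\<^sub>R ?d)" for t
    using C bilinear_rmul[OF bl] by (simp add: carnot_group_step_two_def algebra_simps)
  ultimately have "((\<lambda>t. f (Exp w \<otimes>\<^bsub>G\<^esub> Exp (t *\<^sub>R v))) has_field_derivative
      frechet_derivative ?F (at w) ?d) (at 0)"
    by (simp add: has_field_derivative_def)
  then show ?thesis unfolding left_inv_field_def by (rule DERIV_imp_deriv)
qed

lemma adapted_basis:
  fixes e :: "'n::finite \<Rightarrow> 'g::euclidean_space" and u :: "'m::finite \<Rightarrow> 'g"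
  assumes S: "step_two_stratification br V1 V2"
    and e: "orthonormal_basis e V1" and u: "orthonormal_basis u V2"
  shows "independent (range e \<union> range u)" "span (range e \<union> range u) = UNIV"
    "inj e" "inj u" "range e \<inter> range u = {}"
proof -
  have ind: "independent (range b)" and inj: "inj b" and nz: "0 \<notin> range b"
    if "orthonormal_basis b V" for b :: "'i::finite \<Rightarrow> 'g" and V
  proof -
    have b: "b i \<bullet> b j = (if i = j then 1 else 0)" for i j
      using that by (simp add: orthonormal_basis_def)
    show "inj b" by (metis b injI zero_neq_one)
    show nz: "0 \<notin> range b" by (metis b imageE inner_zero_left zero_neq_one)
    have "pairwise orthogonal (range b)"
      by (auto simp: pairwise_def orthogonal_def b)
    then show "independent (range b)" using nz by (rule pairwise_orthogonal_independent)
  qed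
  have S: "subspace V1" "subspace V2" "V1 \<inter> V2 = {0}" "{v + w |v w. v \<in> V1 \<and> w \<in> V2} = UNIV"
    "span {br v w |v w. v \<in> V1 \<and> w \<in> V1} = V2" "{br v w |v w. v \<in> V1 \<and> w \<in> V2} = {0}"
    using assms(1) unfolding step_two_stratification_def by iprover+
  have V1: "span (range e) = V1" and V2: "span (range u) = V2"
    using e u by (auto simp: orthonormal_basis_def)
  show "inj e" "inj u" using inj e u by auto
  show disj: "range e \<inter> range u = {}"
  proof -
    have False if b: "b \<in> range e" "b \<in> range u" for b
    proof -
      have "b \<in> V1 \<inter> V2" using span_base[OF b(1)] span_base[OF b(2)] unfolding V1 V2 by (rule IntI)
      then have "b = 0" unfolding S(3) by simp
      then show False using b(1) nz[OF e] by simp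
    qed
    then show ?thesis by (auto simp only: disjoint_iff)
  qed
  show sp: "span (range e \<union> range u) = UNIV"
    unfolding span_Un V1 V2 using S(4) by simp
  have "dim {v + w |v w. v \<in> V1 \<and> w \<in> V2} + dim (V1 \<inter> V2) = dim V1 + dim V2"
    by (rule dim_sums_Int[OF S(1,2)])
  then have "DIM('g) = dim V1 + dim V2" unfolding S(3,4) by simp
  also have "\<dots> = card (range e) + card (range u)"
    unfolding V1[symmetric] V2[symmetric] dim_span
    using ind[OF e] ind[OF u] by (simp add: dim_eq_card_independent)
  also have "\<dots> = card (range e \<union> range u)" using disj by (simp add: card_Un_disjoint)
  finally show "independent (range e \<union> range u)"
    using sp card_le_dim_spanning[of "range e \<union> range u" UNIV] by simp
qed

lemma exp_coord_expansion:
  fixes e :: "'n::finite \<Rightarrow> 'g::euclidean_space" and u :: "'m::finite \<Rightarrow> 'g"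
  assumes S: "step_two_stratification br V1 V2"
    and e: "orthonormal_basis e V1" and u: "orthonormal_basis u V2"
  shows "inv_into UNIV Exp p =
    (\<Sum>i\<in>UNIV. exp_coord Exp e u (e i) p *\<^sub>R e i) + (\<Sum>k\<in>UNIV. exp_coord Exp e u (u k) p *\<^sub>R u k)"
proof -
  let ?r = "\<lambda>b. representation (range e \<union> range u) (inv_into UNIV Exp p) b *\<^sub>R b"
  note B = adapted_basis[OF assms]
  have "inv_into UNIV Exp p = (\<Sum>b\<in>range e \<union> range u. ?r b)"
    by (rule sum_representation_eq[symmetric]) (use B(1,2) in auto)
  also have "\<dots> = (\<Sum>b\<in>range e. ?r b) + (\<Sum>b\<in>range u. ?r b)"
    using B(5) by (intro sum.union_disjoint) auto
  also have "\<dots> = (\<Sum>i\<in>UNIV. ?r (e i)) + (\<Sum>k\<in>UNIV. ?r (u k))"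
    by (simp add: sum.reindex[OF B(3)] sum.reindex[OF B(4)])
  finally show ?thesis by (simp add: exp_coord_def)
qed

lemma bracket_expansions:
  fixes e :: "'n::finite \<Rightarrow> 'g::euclidean_space" and u :: "'m::finite \<Rightarrow> 'g"
  assumes C: "carnot_group_step_two G Exp br V1 V2"
    and e: "orthonormal_basis e V1" and u: "orthonormal_basis u V2"
  shows "br (\<Sum>j\<in>UNIV. x j *\<^sub>R e j) (e i) =
      - (\<Sum>k\<in>UNIV. \<Sum>j\<in>UNIV. (structure_constant br e u i j k * x j) *\<^sub>R u k)"
    and "w \<in> V2 \<Longrightarrow> br v w = 0" and "w \<in> V2 \<Longrightarrow> br w v = 0"
proof -
  have L: "lie_bracket br" and S: "step_two_stratification br V1 V2"
    using C unfolding carnot_group_step_two_def by blast+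
  then have bl: "bilinear br" and alt: "br v v = 0"
    and jac: "br u (br v w) + br v (br w u) + br w (br u v) = 0" for u v w
    unfolding lie_bracket_def by blast+
  have S': "subspace V1" "subspace V2" "V1 \<inter> V2 = {0}" "{v + w |v w. v \<in> V1 \<and> w \<in> V2} = UNIV"
    "span {br v w |v w. v \<in> V1 \<and> w \<in> V1} = V2" "{br v w |v w. v \<in> V1 \<and> w \<in> V2} = {0}"
    using S unfolding step_two_stratification_def by iprover+
  have anti: "br v w = - br w v" for v w
    using alt[of "v + w"] alt[of v] alt[of w]
    by (simp add: bilinear_ladd[OF bl] bilinear_radd[OF bl] add_eq_0_iff)
  have V12: "br v w = 0" if "v \<in> V1" "w \<in> V2" for v w
  proof -
    have "br v w \<in> {br v w |v w. v \<in> V1 \<and> w \<in> V2}" using that by blast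
    then show ?thesis unfolding S'(6) by simp
  qed
  have V1w: "br (br a b) w = 0" if ab: "a \<in> V1" "b \<in> V1" and w: "w \<in> V2" for a b w
    using jac[of w a b] V12[OF ab(1) w] V12[OF ab(2) w] anti[of w "br a b"] anti[of w a]
    by (simp add: bilinear_rzero[OF bl])
  have V22: "br v w = 0" if "v \<in> V2" and w: "w \<in> V2" for v w
  proof -
    have "v \<in> span {br v w |v w. v \<in> V1 \<and> w \<in> V1}" unfolding S'(5) by (rule that(1))
    then show ?thesis
      by (induction rule: span_induct_alt)
        (auto simp: bilinear_lzero[OF bl] bilinear_ladd[OF bl] bilinear_lmul[OF bl] V1w[OF _ _ w])
  qed
  show *: "br v w = 0" if w: "w \<in> V2" for v w
  proof -
    obtain a b where "v = a + b" "a \<in> V1" "b \<in> V2" using S'(4) by blast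
    then show ?thesis by (simp add: bilinear_ladd[OF bl] V12 V22 w)
  qed
  show "br w v = 0" if "w \<in> V2" using *[OF that, of v] anti[of w v] by simp
  have inV1: "e i \<in> V1" for i using e by (auto simp: orthonormal_basis_def intro: span_base)
  have exp: "br (e i) (e j) = (\<Sum>k\<in>UNIV. structure_constant br e u i j k *\<^sub>R u k)" for i j
  proof -
    have "br (e i) (e j) \<in> span (range u)"
    proof -
      have "br (e i) (e j) \<in> span {br v w |v w. v \<in> V1 \<and> w \<in> V1}"
        using inV1 by (intro span_base) blast
      then show ?thesis using u unfolding S'(5) by (simp add: orthonormal_basis_def)
    qed
    then obtain c where c: "br (e i) (e j) = (\<Sum>b\<in>range u. c b *\<^sub>R b)"
      by (auto simp: span_finite)
    also have "\<dots> = (\<Sum>k\<in>UNIV. c (u k) *\<^sub>R u k)"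
      by (simp add: sum.reindex[OF adapted_basis(4)[OF S e u]])
    finally have c: "br (e i) (e j) = (\<Sum>k\<in>UNIV. c (u k) *\<^sub>R u k)" .
    have "u l \<bullet> u k = (if l = k then 1 else 0)" for l k
      using u by (simp add: orthonormal_basis_def)
    then have "structure_constant br e u i j k = c (u k)" for k
      unfolding structure_constant_def c
      by (simp add: inner_sum_left if_distrib[of "(*) _"] cong: if_cong)
    then show ?thesis using c by simp
  qed
  interpret l: Real_Vector_Spaces.linear "\<lambda>v. br v (e i)"
    using bl by (simp add: bilinear_def)
  have "br (\<Sum>j\<in>UNIV. x j *\<^sub>R e j) (e i) = (\<Sum>j\<in>UNIV. x j *\<^sub>R br (e j) (e i))"
    by (simp add: l.sum l.scale)
  also have "\<dots> = (\<Sum>j\<in>UNIV. - (x j *\<^sub>R br (e i) (e j)))"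
    by (intro sum.cong refl, subst anti) simp
  also have "\<dots> = - (\<Sum>j\<in>UNIV. \<Sum>k\<in>UNIV. (structure_constant br e u i j k * x j) *\<^sub>R u k)"
    by (simp add: exp scaleR_sum_right sum_negf mult.commute)
  also have "\<dots> = - (\<Sum>k\<in>UNIV. \<Sum>j\<in>UNIV. (structure_constant br e u i j k * x j) *\<^sub>R u k)"
    by (subst sum.swap) simp
  finally show "br (\<Sum>j\<in>UNIV. x j *\<^sub>R e j) (e i) =
      - (\<Sum>k\<in>UNIV. \<Sum>j\<in>UNIV. (structure_constant br e u i j k * x j) *\<^sub>R u k)" .
qed

lemma left_inv_field_coordinates:
  fixes e :: "'n::finite \<Rightarrow> 'g::euclidean_space" and u :: "'m::finite \<Rightarrow> 'g"
  assumes C: "carnot_group_step_two G Exp br V1 V2"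
    and e: "orthonormal_basis e V1" and u: "orthonormal_basis u V2"
    and f: "smooth_fun Exp f" and p: "p \<in> carrier G"
  defines "dF \<equiv> frechet_derivative (\<lambda>v. f (Exp v)) (at (inv_into UNIV Exp p))"
  shows "left_inv_field G Exp (u k) f p = dF (u k)"
    and "left_inv_field G Exp (e i) f p = dF (e i) -
      1/2 * (\<Sum>k\<in>UNIV. \<Sum>j\<in>UNIV. structure_constant br e u i j k * exp_coord Exp e u (e j) p *
        left_inv_field G Exp (u k) f p)"
proof -
  let ?w = "inv_into UNIV Exp p"
  let ?x = "\<lambda>j. exp_coord Exp e u (e j) p" and ?z = "\<lambda>k. exp_coord Exp e u (u k) p"
  have S: "step_two_stratification br V1 V2" and bl: "bilinear br"
    and bij: "bij_betw Exp UNIV (carrier G)"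
    using C by (auto simp: carnot_group_step_two_def lie_bracket_def)
  have w: "Exp ?w = p" using bij p by (simp add: bij_betw_def f_inv_into_f)
  have "Ck (Suc 0) (\<lambda>v. f (Exp v))" using f unfolding smooth_fun_def smooth_def by blast
  then have "linear dF"
    unfolding dF_def by (auto intro!: linear_frechet_derivative)
  then interpret l: Real_Vector_Spaces.linear dF .
  have V2: "span (range u) = V2" using u by (simp add: orthonormal_basis_def)
  have uV: "u k \<in> V2" for k using V2 by (auto intro: span_base)
  have zV: "(\<Sum>k\<in>UNIV. ?z k *\<^sub>R u k) \<in> V2"
    unfolding V2[symmetric] by (rule span_sum, rule span_scale, rule span_base, rule rangeI)
  show Z: "left_inv_field G Exp (u k) f p = dF (u k)" for k
    using left_inv_field_Exp[OF C f, of "u k" ?w] bracket_expansions(2)[OF C e u uV]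
    by (simp add: w dF_def)
  have "br ?w (e i) = - (\<Sum>k\<in>UNIV. \<Sum>j\<in>UNIV. (structure_constant br e u i j k * ?x j) *\<^sub>R u k)"
    by (subst exp_coord_expansion[OF S e u])
      (simp add: bilinear_ladd[OF bl] bracket_expansions(1)[OF C e u] bracket_expansions(3)[OF C e u zV])
  then show "left_inv_field G Exp (e i) f p = dF (e i) -
      1/2 * (\<Sum>k\<in>UNIV. \<Sum>j\<in>UNIV. structure_constant br e u i j k * ?x j *
        left_inv_field G Exp (u k) f p)"
    using left_inv_field_Exp[OF C f, of "e i" ?w]
    by (simp add: w Z dF_def[symmetric] l.add l.diff l.scale l.neg l.sum)
qed

lemma dilation_field_generates:
  fixes e :: "'n::finite \<Rightarrow> 'g::euclidean_space" and u :: "'m::finite \<Rightarrow> 'g"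
  assumes C: "carnot_group_step_two G Exp br V1 V2"
    and e: "orthonormal_basis e V1" and u: "orthonormal_basis u V2"
    and f: "smooth_fun Exp f" and p: "p \<in> carrier G"
  shows "((\<lambda>s. f (dilation Exp V1 V2 (exp s) p)) has_real_derivative
    dilation_field G Exp e u f p) (at 0)"
proof -
  let ?w = "inv_into UNIV Exp p" and ?F = "\<lambda>v. f (Exp v)"
  let ?dF = "frechet_derivative ?F (at ?w)"
  let ?x = "\<lambda>j. exp_coord Exp e u (e j) p" and ?z = "\<lambda>k. exp_coord Exp e u (u k) p"
  let ?g = "\<lambda>i j k. structure_constant br e u i j k"
  let ?v1 = "\<Sum>i\<in>UNIV. ?x i *\<^sub>R e i" and ?v2 = "\<Sum>k\<in>UNIV. ?z k *\<^sub>R u k"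
  have S: "step_two_stratification br V1 V2" and bl: "bilinear br" and alt: "\<And>v. br v v = 0"
    and bij: "bij_betw Exp UNIV (carrier G)"
    using C by (auto simp: carnot_group_step_two_def lie_bracket_def)
  have S': "subspace V1" "subspace V2" "V1 \<inter> V2 = {0}" "{v + w |v w. v \<in> V1 \<and> w \<in> V2} = UNIV"
    "span {br v w |v w. v \<in> V1 \<and> w \<in> V1} = V2" "{br v w |v w. v \<in> V1 \<and> w \<in> V2} = {0}"
    using S unfolding step_two_stratification_def by iprover+
  have w: "?w = ?v1 + ?v2" by (rule exp_coord_expansion[OF S e u])
  have Ew: "Exp ?w = p" using bij p by (simp add: bij_betw_def f_inv_into_f)
  have V: "V1 = span (range e)" "V2 = span (range u)"
    using e u by (auto simp: orthonormal_basis_def)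
  have V1: "?v1 \<in> V1"
    unfolding V by (rule span_sum, rule span_scale, rule span_base, rule rangeI)
  have V2: "?v2 \<in> V2"
    unfolding V by (rule span_sum, rule span_scale, rule span_base, rule rangeI)
  have dil: "dilation Exp V1 V2 t p = Exp (t *\<^sub>R ?v1 + t\<^sup>2 *\<^sub>R ?v2)" for t
  proof -
    have uniq: "v = ?v1 \<and> v' = ?v2" if "v \<in> V1" "v' \<in> V2" "?w = v + v'" for v v'
    proof -
      have eq: "v - ?v1 = ?v2 - v'" using that(3) unfolding w by (simp add: algebra_simps)
      have "v - ?v1 \<in> V1" using S'(1) that(1) V1 by (rule subspace_diff)
      moreover have "v - ?v1 \<in> V2" unfolding eq using S'(2) V2 that(2) by (rule subspace_diff)
      ultimately have "v - ?v1 = 0" using S'(3) by blast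
      with eq show ?thesis by simp
    qed
    have "(THE y. \<exists>v\<in>V1. \<exists>v'\<in>V2. ?w = v + v' \<and> y = t *\<^sub>R v + t\<^sup>2 *\<^sub>R v') =
        t *\<^sub>R ?v1 + t\<^sup>2 *\<^sub>R ?v2"
      using V1 V2 w uniq by (intro the_equality) blast+
    then show ?thesis by (simp add: dilation_def)
  qed
  have "Ck (Suc 0) ?F" using f unfolding smooth_fun_def smooth_def by blast
  then have "(?F has_derivative ?dF) (at ?w)"
    by (simp add: frechet_derivative_works)
  then have F: "(?F has_derivative ?dF) (at (exp 0 *\<^sub>R ?v1 + (exp 0)\<^sup>2 *\<^sub>R ?v2))"
    by (simp flip: w)
  then interpret l: Real_Vector_Spaces.linear ?dF by (rule has_derivative_linear)
  have "((\<lambda>s::real. exp s *\<^sub>R ?v1 + (exp s)\<^sup>2 *\<^sub>R ?v2) has_derivative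
      (\<lambda>s. s *\<^sub>R (?v1 + 2 *\<^sub>R ?v2))) (at 0)"
    by (auto intro!: derivative_eq_intros simp: algebra_simps)
  from has_derivative_compose[OF this F]
  have D: "((\<lambda>s. f (dilation Exp V1 V2 (exp s) p)) has_real_derivative ?dF (?v1 + 2 *\<^sub>R ?v2)) (at 0)"
    unfolding dil has_field_derivative_def
    by (simp add: l.scale mult_commute_abs del: scaleR_add_right)
  have Zf: "left_inv_field G Exp (u k) f p = ?dF (u k)" for k
    by (rule left_inv_field_coordinates(1)[OF C e u f p])
  have Xf: "left_inv_field G Exp (e i) f p = ?dF (e i) + 1/2 * ?dF (br ?v1 (e i))" for i
    unfolding left_inv_field_coordinates(2)[OF C e u f p] Zf bracket_expansions(1)[OF C e u]
    by (simp add: l.neg l.sum l.scale)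
  interpret b: Real_Vector_Spaces.linear "br ?v1" using bl by (simp add: bilinear_def)
  have "(\<Sum>i\<in>UNIV. ?x i * ?dF (br ?v1 (e i))) = ?dF (br ?v1 ?v1)"
    unfolding b.sum l.sum b.scale l.scale by simp
  then have "(\<Sum>i\<in>UNIV. ?x i * ?dF (br ?v1 (e i))) = 0" by (simp add: alt l.zero)
  moreover have "dilation_field G Exp e u f p =
      (\<Sum>i\<in>UNIV. ?x i * ?dF (e i)) + 1/2 * (\<Sum>i\<in>UNIV. ?x i * ?dF (br ?v1 (e i)))
      + 2 * (\<Sum>k\<in>UNIV. ?z k * ?dF (u k))"
    unfolding dilation_field_def Xf Zf
    by (simp add: distrib_left sum.distrib sum_divide_distrib)
  ultimately have "dilation_field G Exp e u f p = ?dF (?v1 + 2 *\<^sub>R ?v2)"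
    by (simp add: l.add l.sum l.scale)
  with D show ?thesis by simp
qed

end

theory Submission
  imports Defs
begin

text \<open>
  Write \<open>X i\<close> and \<open>Z k\<close> for the left-invariant fields of \<open>e i\<close> and \<open>u k\<close>, \<open>\<gamma> i j k\<close> for the
  structure constants, and \<open>L\<close> for the sub-Laplacian minus the generator \<open>D\<close> of the dilations. For
  a second-order operator of this kind, the iteration of \<open>\<Sum>k. (Y k f)\<^sup>2\<close> equals
  \<open>(\<Sum>k i. (X i (Y k f))\<^sup>2) + (\<Sum>k. Y k f * [L, Y k] f)\<close> (lemma \<open>iterated_gradient_form\<close>), so that
  everything depends on the commutators of \<open>L\<close> with the fields (lemma \<open>L_commutator\<close>). These
  follow from two facts: the \<open>X i\<close> satisfy the relations \<open>[X i, X j] = (\<Sum>k. \<gamma> i j k * Z k)\<close> of the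
  Lie algebra with central \<open>Z k\<close> (lemma \<open>W_commutator\<close>), and \<open>X i\<close>, \<open>Z k\<close> are homogeneous of
  degree 1 and 2 (lemma \<open>W_dil_commutator\<close>), whence \<open>[- D, X i] = X i\<close> and \<open>[- D, Z k] = 2 Z k\<close>.
  The result is the pair of identities

    \<^item> \<open>\<Gamma>\<^sub>2 = (\<Sum>i j. (X j (X i f))\<^sup>2) + 2 (\<Sum>i j k. \<gamma> j i k * X i f * X j (Z k f)) + \<Gamma>\<close>,
    \<^item> \<open>\<Gamma>\<^sub>2\<^sup>Z = (\<Sum>j k. (X j (Z k f))\<^sup>2) + 2 \<Gamma>\<^sup>Z\<close>.

  The antisymmetric part of the matrix of the \<open>X j (X i f)\<close> is given by the bracket relations, and
  its squared norm is at least \<open>rho2 * \<Gamma>\<^sup>Z\<close>. Completing the square, the mixed terms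
  \<open>2 \<gamma> j i k * X i f * X j (Z k f)\<close> together with \<open>\<epsilon>\<close> times the squares in the second identity are
  at least \<open>- (kappa / \<epsilon>) * \<Gamma>\<close>. Adding up gives the inequality (lemma \<open>curvature_dimension\<close>).

  The exponential map turns the operators into derivatives along polynomial vector fields on the
  Lie algebra. Their commutators can be computed there from the symmetry of second derivatives
  (lemma \<open>field_deriv_commutator\<close>).
\<close>

section \<open>Calculus of smooth functions\<close>

(* Hypotheses Ck (Suc k) F are to reach the closure rules below in folded form. *)
declare Ck.simps(2) [simp del]

lemma Ck_directional: "Ck (Suc k) F \<Longrightarrow> Ck k (\<lambda>x. frechet_derivative F (at x) v)"
  by (simp add: Ck.simps(2))

lemma Ck_SucD: "Ck (Suc k) F \<Longrightarrow> Ck k F"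
proof (induction k arbitrary: F)
  case 0
  then show ?case
    by (auto simp: Ck.simps(2) intro!: continuous_at_imp_continuous_on
        differentiable_imp_continuous_within)
next
  case (Suc k)
  from Suc.prems have d: "\<forall>x. F differentiable (at x)"
    and s: "\<And>v. Ck (Suc k) (\<lambda>x. frechet_derivative F (at x) v)"
    using Ck.simps(2)[of "Suc k" F] by blast+
  show ?case using d Suc.IH[OF s] by (simp add: Ck.simps(2))
qed

text \<open>Any family of derivatives will do, so that the closure properties below can be read off from
  the usual rules for derivatives.\<close>
lemma Ck_SucI:
  assumes "\<And>x. (F has_derivative F' x) (at x)" "\<And>v. Ck k (\<lambda>x. F' x v)"
  shows "Ck (Suc k) F"
proof -
  have "frechet_derivative F (at x) = F' x" for x
    using frechet_derivative_at[OF assms(1)] by simp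
  then show ?thesis using assms by (auto simp: Ck.simps(2) differentiable_def)
qed

lemma Ck_has_derivative:
  "Ck (Suc k) F \<Longrightarrow> (F has_derivative frechet_derivative F (at x)) (at x)"
  by (simp add: Ck.simps(2) frechet_derivative_works)

lemma Ck_const: "Ck k (\<lambda>x. c)"
proof (induction k arbitrary: c)
  case (Suc k)
  show ?case by (rule Ck_SucI[where F'="\<lambda>x v. 0"]) (auto intro: Suc)
qed simp

lemma Ck_bounded_linear: "bounded_linear A \<Longrightarrow> Ck k A"
proof (cases k)
  case 0
  assume "bounded_linear A"
  with 0 show ?thesis by (simp add: linear_continuous_on)
next
  case (Suc l)
  assume "bounded_linear A"
  then show ?thesis unfolding Suc
    by (intro Ck_SucI[where F'="\<lambda>x. A"] Ck_const bounded_linear_imp_has_derivative)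
qed

lemma Ck_compose_bounded_linear:
  "bounded_linear A \<Longrightarrow> Ck k F \<Longrightarrow> Ck k (\<lambda>x. A (F x))"
proof (induction k arbitrary: F)
  case 0
  then show ?case
    by (auto intro: bounded_linear.continuous_on)
next
  case (Suc k)
  show ?case
    by (rule Ck_SucI[where F'="\<lambda>x v. A (frechet_derivative F (at x) v)"])
       (use Suc in \<open>auto intro: bounded_linear.has_derivative Ck_has_derivative Ck_directional\<close>)
qed

lemma Ck_add: "Ck k F \<Longrightarrow> Ck k H \<Longrightarrow> Ck k (\<lambda>x. F x + H x)"
proof (induction k arbitrary: F H)
  case 0
  then show ?case by (auto intro: continuous_on_add)
next
  case (Suc k)
  show ?case
    by (rule Ck_SucI[where F'="\<lambda>x v. frechet_derivative F (at x) v + frechet_derivative H (at x) v"])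
       (use Suc in \<open>auto intro: has_derivative_add Ck_has_derivative Ck_directional\<close>)
qed

lemma Ck_mult:
  fixes F H :: "'a::real_normed_vector \<Rightarrow> real"
  shows "Ck k F \<Longrightarrow> Ck k H \<Longrightarrow> Ck k (\<lambda>x. F x * H x)"
proof (induction k arbitrary: F H)
  case 0
  then show ?case by (auto intro: continuous_on_mult)
next
  case (Suc k)
  show ?case
    by (rule Ck_SucI[where F'="\<lambda>x v. F x * frechet_derivative H (at x) v
        + frechet_derivative F (at x) v * H x"])
       (use Suc Ck_SucD[OF Suc.prems(1)] Ck_SucD[OF Suc.prems(2)] in
         \<open>auto intro: has_derivative_mult Ck_has_derivative Ck_directional intro!: Ck_add Suc.IH\<close>)
qed

lemma smooth_has_derivative:
  "smooth F \<Longrightarrow> (F has_derivative frechet_derivative F (at x)) (at x)"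
  unfolding smooth_def by (blast intro: Ck_has_derivative)

lemma smooth_directional: "smooth F \<Longrightarrow> smooth (\<lambda>x. frechet_derivative F (at x) v)"
  unfolding smooth_def by (blast intro: Ck_directional)

lemma smooth_const: "smooth (\<lambda>x. c)"
  by (simp add: smooth_def Ck_const)

lemma smooth_linear:
  fixes A :: "'a::euclidean_space \<Rightarrow> 'b::real_normed_vector"
  shows "linear A \<Longrightarrow> smooth A"
  by (simp add: smooth_def Ck_bounded_linear linear_conv_bounded_linear)

lemma smooth_compose_linear:
  fixes A :: "'b::euclidean_space \<Rightarrow> 'c::real_normed_vector"
  shows "linear A \<Longrightarrow> smooth F \<Longrightarrow> smooth (\<lambda>x. A (F x))"
  by (simp add: smooth_def Ck_compose_bounded_linear linear_conv_bounded_linear)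

lemma smooth_add: "smooth F \<Longrightarrow> smooth H \<Longrightarrow> smooth (\<lambda>x. F x + H x)"
  by (simp add: smooth_def Ck_add)

lemma smooth_mult:
  fixes F H :: "'a::euclidean_space \<Rightarrow> real"
  shows "smooth F \<Longrightarrow> smooth H \<Longrightarrow> smooth (\<lambda>x. F x * H x)"
  by (simp add: smooth_def Ck_mult)

lemma smooth_diff:
  fixes F H :: "'a::euclidean_space \<Rightarrow> real"
  assumes "smooth F" "smooth H"
  shows "smooth (\<lambda>x. F x - H x)"
  using smooth_add[OF assms(1) smooth_mult[OF smooth_const[of "-1"] assms(2)]] by simp

lemma smooth_sum:
  assumes "\<And>i. i \<in> I \<Longrightarrow> smooth (F i)"
  shows "smooth (\<lambda>x. \<Sum>i\<in>I. F i x)"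
  using assms by (induction I rule: infinite_finite_induct) (auto simp: smooth_const smooth_add)

text \<open>The second difference is symmetric in \<open>a\<close> and \<open>b\<close>, the mixed derivative a priori not; this
  is what makes mixed derivatives commute. Two applications of the mean value theorem prove it,
  one in the direction \<open>a\<close> for the increment along \<open>b\<close>, one in the direction \<open>b\<close> for the
  derivative along \<open>a\<close>.\<close>
lemma second_difference_mean_value:
  fixes H :: "'a::real_normed_vector \<Rightarrow> real"
  assumes "Ck 2 H" and h: "h > 0"
  shows "\<exists>\<xi> \<eta>. 0 < \<xi> \<and> \<xi> < h \<and> 0 < \<eta> \<and> \<eta> < h \<and>
    H (x + h *\<^sub>R a + h *\<^sub>R b) - H (x + h *\<^sub>R b) - H (x + h *\<^sub>R a) + H x =
      h\<^sup>2 * frechet_derivative (\<lambda>y. frechet_derivative H (at y) a) (at (x + \<xi> *\<^sub>R a + \<eta> *\<^sub>R b)) b"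
proof -
  let ?P = "\<lambda>y. frechet_derivative H (at y) a"
  have "Ck (Suc 1) H" "Ck (Suc 0) ?P" using assms by (simp_all add: numeral_2_eq_2 Ck_directional)
  then have H: "(H has_derivative frechet_derivative H (at y)) (at y)"
    and P: "(?P has_derivative frechet_derivative ?P (at y)) (at y)" for y
    by (blast intro: Ck_has_derivative)+
  have line: "((\<lambda>t. F (y + t *\<^sub>R c)) has_real_derivative F' (y + s *\<^sub>R c) c) (at s)"
    if F: "\<And>y. (F has_derivative F' y) (at y)" for F :: "'a \<Rightarrow> real" and F' y c s
  proof -
    interpret l: Real_Vector_Spaces.linear "F' (y + s *\<^sub>R c)" by (rule has_derivative_linear[OF F])
    have "((\<lambda>t. y + t *\<^sub>R c) has_derivative (\<lambda>t. t *\<^sub>R c)) (at s)"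
      by (auto intro!: derivative_eq_intros)
    from has_derivative_compose[OF this F]
    show ?thesis unfolding has_field_derivative_def by (simp add: l.scale mult_commute_abs)
  qed
  let ?g = "\<lambda>t. H ((x + h *\<^sub>R b) + t *\<^sub>R a) - H (x + t *\<^sub>R a)"
  have "(?g has_real_derivative ?P ((x + h *\<^sub>R b) + t *\<^sub>R a) - ?P (x + t *\<^sub>R a)) (at t)" for t
    by (intro DERIV_diff line[OF H])
  from MVT2[OF h this] obtain \<xi> where \<xi>: "0 < \<xi>" "\<xi> < h"
    "?g h - ?g 0 = h * (?P ((x + h *\<^sub>R b) + \<xi> *\<^sub>R a) - ?P (x + \<xi> *\<^sub>R a))" by auto
  from MVT2[OF h line[OF P, of "x + \<xi> *\<^sub>R a" b]] obtain \<eta> where \<eta>: "0 < \<eta>" "\<eta> < h"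
    "?P (x + \<xi> *\<^sub>R a + h *\<^sub>R b) - ?P (x + \<xi> *\<^sub>R a) =
       h * frechet_derivative ?P (at (x + \<xi> *\<^sub>R a + \<eta> *\<^sub>R b)) b" by auto
  have "?g h - ?g 0 = h * (h * frechet_derivative ?P (at (x + \<xi> *\<^sub>R a + \<eta> *\<^sub>R b)) b)"
    unfolding \<xi>(3) \<eta>(3)[symmetric] by (simp add: add_ac)
  then have "H (x + h *\<^sub>R a + h *\<^sub>R b) - H (x + h *\<^sub>R b) - H (x + h *\<^sub>R a) + H x =
      h\<^sup>2 * frechet_derivative ?P (at (x + \<xi> *\<^sub>R a + \<eta> *\<^sub>R b)) b"
    by (simp add: power2_eq_square add_ac)
  with \<xi> \<eta> show ?thesis by blast
qed

text \<open>Schwarz's theorem. Divided by the square of the step, the symmetric second difference tends to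
  both mixed derivatives, since these are continuous.\<close>
lemma mixed_directional_derivatives_commute:
  fixes H :: "'a::real_normed_vector \<Rightarrow> real"
  assumes C: "Ck 2 H"
  shows "frechet_derivative (\<lambda>y. frechet_derivative H (at y) a) (at x) b =
         frechet_derivative (\<lambda>y. frechet_derivative H (at y) b) (at x) a"
proof -
  let ?D = "\<lambda>a b x. frechet_derivative (\<lambda>y. frechet_derivative H (at y) a) (at x) b"
  define \<Delta> where "\<Delta> a b h = H (x + h *\<^sub>R a + h *\<^sub>R b) - H (x + h *\<^sub>R b) - H (x + h *\<^sub>R a) + H x"
      for a b h
  have lim: "(\<lambda>n. \<Delta> a b (1 / real (Suc n)) / (1 / real (Suc n))\<^sup>2) \<longlonglongrightarrow> ?D a b x" for a b
  proof -
    define h where "h n = 1 / real (Suc n)" for n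
    have h0: "h n > 0" for n by (simp add: h_def)
    have hlim: "h \<longlonglongrightarrow> 0" unfolding h_def by (rule LIMSEQ_Suc[OF lim_1_over_n])
    obtain \<xi> \<eta> where *: "\<And>n. 0 < \<xi> n" "\<And>n. \<xi> n < h n" "\<And>n. 0 < \<eta> n" "\<And>n. \<eta> n < h n"
      "\<And>n. \<Delta> a b (h n) = (h n)\<^sup>2 * ?D a b (x + \<xi> n *\<^sub>R a + \<eta> n *\<^sub>R b)"
      unfolding \<Delta>_def using second_difference_mean_value[OF C h0, of _ x a b] by metis
    have "\<xi> \<longlonglongrightarrow> 0" "\<eta> \<longlonglongrightarrow> 0"
      by (rule tendsto_sandwich[OF _ _ tendsto_const hlim];
          intro always_eventually allI less_imp_le *)+
    then have "(\<lambda>n. x + \<xi> n *\<^sub>R a + \<eta> n *\<^sub>R b) \<longlonglongrightarrow> x + 0 *\<^sub>R a + 0 *\<^sub>R b"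
      by (intro tendsto_intros)
    then have arg: "(\<lambda>n. x + \<xi> n *\<^sub>R a + \<eta> n *\<^sub>R b) \<longlonglongrightarrow> x" by simp
    have "continuous_on UNIV (?D a b)" using C by (simp add: numeral_2_eq_2 Ck.simps(2))
    then have "isCont (?D a b) x" by (simp add: continuous_on_eq_continuous_at)
    from isCont_tendsto_compose[OF this arg]
    have "(\<lambda>n. ?D a b (x + \<xi> n *\<^sub>R a + \<eta> n *\<^sub>R b)) \<longlonglongrightarrow> ?D a b x" .
    moreover have "\<Delta> a b (h n) / (h n)\<^sup>2 = ?D a b (x + \<xi> n *\<^sub>R a + \<eta> n *\<^sub>R b)" for n
      using *(5)[of n] h0[of n] by simp
    ultimately show ?thesis by (simp add: h_def)
  qed
  have "\<Delta> a b h = \<Delta> b a h" for h by (simp add: \<Delta>_def add_ac)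
  with lim[of b a] have "(\<lambda>n. \<Delta> a b (1 / real (Suc n)) / (1 / real (Suc n))\<^sup>2) \<longlonglongrightarrow> ?D b a x" by simp
  with lim[of a b] show ?thesis by (rule LIMSEQ_unique)
qed

section \<open>Smooth vector fields as first-order operators\<close>

definition field_deriv :: "('a::euclidean_space \<Rightarrow> 'a) \<Rightarrow> ('a \<Rightarrow> real) \<Rightarrow> 'a \<Rightarrow> real" where
  "field_deriv a F x = frechet_derivative F (at x) (a x)"

lemma field_deriv_eqI: "(F has_derivative F') (at x) \<Longrightarrow> field_deriv a F x = F' (a x)"
  unfolding field_deriv_def using frechet_derivative_at[of F F' x] by simp

lemma field_deriv_const: "field_deriv a (\<lambda>x. c) x = 0"
  by (simp add: field_deriv_def)

lemma field_deriv_mult: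
  assumes "smooth F" "smooth H"
  shows "field_deriv a (\<lambda>x. F x * H x) x = F x * field_deriv a H x + field_deriv a F x * H x"
  using field_deriv_eqI[OF has_derivative_mult[OF smooth_has_derivative[OF assms(1)]
      smooth_has_derivative[OF assms(2)]], of a]
  by (simp add: field_deriv_def)

lemma field_deriv_add:
  assumes "smooth F" "smooth H"
  shows "field_deriv a (\<lambda>x. F x + H x) x = field_deriv a F x + field_deriv a H x"
  using field_deriv_eqI[OF has_derivative_add[OF smooth_has_derivative[OF assms(1)]
      smooth_has_derivative[OF assms(2)]], of a]
  by (simp add: field_deriv_def)

lemma field_deriv_diff:
  assumes "smooth F" "smooth H"
  shows "field_deriv a (\<lambda>x. F x - H x) x = field_deriv a F x - field_deriv a H x"
  using field_deriv_eqI[OF has_derivative_diff[OF smooth_has_derivative[OF assms(1)]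
      smooth_has_derivative[OF assms(2)]], of a]
  by (simp add: field_deriv_def)

lemma field_deriv_sum:
  assumes "\<And>i. i \<in> I \<Longrightarrow> smooth (F i)"
  shows "field_deriv a (\<lambda>x. \<Sum>i\<in>I. F i x) x = (\<Sum>i\<in>I. field_deriv a (F i) x)"
proof -
  have "((\<lambda>x. \<Sum>i\<in>I. F i x) has_derivative (\<lambda>v. \<Sum>i\<in>I. frechet_derivative (F i) (at x) v)) (at x)"
    by (intro has_derivative_sum smooth_has_derivative assms)
  from field_deriv_eqI[OF this, of a] show ?thesis by (simp add: field_deriv_def)
qed

text \<open>A derivative along a variable field is thereby a finite sum of products of a coefficient
  function with a derivative in a constant direction, to which the closure and product rules
  apply.\<close>
lemma frechet_derivative_basis_expansion:
  assumes "smooth F"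
  shows "frechet_derivative F (at x) v = (\<Sum>b\<in>Basis. (v \<bullet> b) * frechet_derivative F (at x) b)"
proof -
  interpret l: Real_Vector_Spaces.linear "frechet_derivative F (at x)"
    by (rule has_derivative_linear[OF smooth_has_derivative[OF assms]])
  have "frechet_derivative F (at x) v = frechet_derivative F (at x) (\<Sum>b\<in>Basis. (v \<bullet> b) *\<^sub>R b)"
    by (simp add: euclidean_representation)
  also have "\<dots> = (\<Sum>b\<in>Basis. (v \<bullet> b) * frechet_derivative F (at x) b)"
    by (simp add: l.sum l.scale del: euclidean_representation)
  finally show ?thesis .
qed

lemma smooth_inner: "smooth a \<Longrightarrow> smooth (\<lambda>x. a x \<bullet> (b::'b::euclidean_space))"
  by (rule smooth_compose_linear) (auto intro: bounded_linear.linear bounded_linear_inner_left)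

lemma smooth_field_deriv:
  assumes "smooth a" "smooth F"
  shows "smooth (field_deriv a F)"
proof -
  have "field_deriv a F = (\<lambda>x. \<Sum>b\<in>Basis. (a x \<bullet> b) * frechet_derivative F (at x) b)"
    by (auto simp: field_deriv_def fun_eq_iff intro: frechet_derivative_basis_expansion[OF assms(2)])
  then show ?thesis
    using assms by (auto intro!: smooth_sum smooth_mult smooth_directional smooth_inner)
qed

text \<open>The first summand is the second derivative of \<open>F\<close> on the values of \<open>a\<close> and \<open>b\<close> at \<open>x\<close>; it is
  symmetric, so that only the second one survives in a commutator.\<close>
lemma field_deriv_twice:
  assumes a: "smooth a" and b: "smooth b" and F: "smooth F"
  shows "field_deriv a (field_deriv b F) x =
    frechet_derivative (\<lambda>y. frechet_derivative F (at y) (b x)) (at x) (a x) +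
    frechet_derivative F (at x) (frechet_derivative b (at x) (a x))"
proof -
  let ?d = "\<lambda>c y. frechet_derivative F (at y) c"
  have ex: "field_deriv b F = (\<lambda>y. \<Sum>c\<in>Basis. (b y \<bullet> c) * ?d c y)"
    by (auto simp: field_deriv_def fun_eq_iff intro: frechet_derivative_basis_expansion[OF F])
  have sm: "smooth (?d c)" for c by (rule smooth_directional[OF F])
  have "field_deriv a (field_deriv b F) x = (\<Sum>c\<in>Basis. field_deriv a (\<lambda>y. (b y \<bullet> c) * ?d c y) x)"
    unfolding ex by (rule field_deriv_sum) (intro smooth_mult sm smooth_inner b)
  also have "\<dots> = (\<Sum>c\<in>Basis. (b x \<bullet> c) * field_deriv a (?d c) x +
      (frechet_derivative b (at x) (a x) \<bullet> c) * ?d c x)"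
  proof (rule sum.cong[OF refl])
    fix c :: 'a
    have "field_deriv a (\<lambda>y. b y \<bullet> c) x = frechet_derivative b (at x) (a x) \<bullet> c"
      by (rule field_deriv_eqI[OF has_derivative_inner_left[OF smooth_has_derivative[OF b]]])
    then show "field_deriv a (\<lambda>y. (b y \<bullet> c) * ?d c y) x = (b x \<bullet> c) * field_deriv a (?d c) x +
      (frechet_derivative b (at x) (a x) \<bullet> c) * ?d c x"
      by (simp add: field_deriv_mult[OF smooth_inner[OF b] sm])
  qed
  also have "\<dots> = (\<Sum>c\<in>Basis. (b x \<bullet> c) * field_deriv a (?d c) x) +
      (\<Sum>c\<in>Basis. (frechet_derivative b (at x) (a x) \<bullet> c) * ?d c x)"
    by (rule sum.distrib)
  also have "(\<Sum>c\<in>Basis. (b x \<bullet> c) * field_deriv a (?d c) x) =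
      field_deriv a (\<lambda>y. \<Sum>c\<in>Basis. (b x \<bullet> c) * ?d c y) x"
    by (subst field_deriv_sum) (auto intro!: smooth_mult sm smooth_const
        simp: field_deriv_mult sm smooth_const field_deriv_const)
  also have "(\<lambda>y. \<Sum>c\<in>Basis. (b x \<bullet> c) * ?d c y) = ?d (b x)"
    by (rule ext) (rule frechet_derivative_basis_expansion[OF F, symmetric])
  also have "(\<Sum>c\<in>Basis. (frechet_derivative b (at x) (a x) \<bullet> c) * ?d c x) =
      ?d (frechet_derivative b (at x) (a x)) x"
    by (rule frechet_derivative_basis_expansion[OF F, symmetric])
  finally show ?thesis by (simp add: field_deriv_def[of a "?d (b x)"])
qed

lemma field_deriv_commutator:
  assumes a: "smooth a" and b: "smooth b" and F: "smooth F"
  shows "field_deriv a (field_deriv b F) x - field_deriv b (field_deriv a F) x =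
    field_deriv (\<lambda>x. frechet_derivative b (at x) (a x) - frechet_derivative a (at x) (b x)) F x"
proof -
  interpret l: Real_Vector_Spaces.linear "frechet_derivative F (at x)"
    by (rule has_derivative_linear[OF smooth_has_derivative[OF F]])
  have "Ck 2 F" using F by (simp add: smooth_def)
  from mixed_directional_derivatives_commute[OF this, of "b x" x "a x"] show ?thesis
    unfolding field_deriv_twice[OF a b F] field_deriv_twice[OF b a F]
    by (simp add: field_deriv_def l.diff)
qed

text \<open>The Bochner identity for an operator \<open>L\<close> that is a sum of squares of fields \<open>X i\<close> plus a
  first-order term. By the product rule \<open>L (H\<^sup>2) = 2 H L H + 2 (\<Sum>i. (X i H)\<^sup>2)\<close>; applied to each
  \<open>H = Y k F\<close> this gives the squares of the second derivatives, and what is left over is the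
  commutator of \<open>L\<close> with \<open>Y k\<close>. The first-order term contributes to the commutator only.\<close>
lemma iterated_gradient_form:
  fixes X :: "'i::finite \<Rightarrow> 'a::euclidean_space \<Rightarrow> 'a" and Y :: "'k::finite \<Rightarrow> 'a \<Rightarrow> 'a"
  assumes X: "\<And>i. smooth (X i)" and Y: "\<And>k. smooth (Y k)" and D: "smooth D" and F: "smooth F"
  defines "L \<equiv> \<lambda>H x. (\<Sum>i\<in>UNIV. field_deriv (X i) (field_deriv (X i) H) x) - field_deriv D H x"
  shows "iterated_form L (gradient_form (\<lambda>k. field_deriv (Y k))) F x =
    (\<Sum>k\<in>UNIV. \<Sum>i\<in>UNIV. (field_deriv (X i) (field_deriv (Y k) F) x)\<^sup>2) +
    (\<Sum>k\<in>UNIV. field_deriv (Y k) F x * (L (field_deriv (Y k) F) x - field_deriv (Y k) (L F) x))"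
proof -
  have sY: "smooth (field_deriv (Y k) F)" for k by (rule smooth_field_deriv[OF Y F])
  have L_square: "L (\<lambda>x. H x * H x) x = 2 * H x * L H x + 2 * (\<Sum>i\<in>UNIV. (field_deriv (X i) H x)\<^sup>2)"
    if H: "smooth H" for H
  proof -
    have sX: "smooth (field_deriv (X i) H)" for i by (rule smooth_field_deriv[OF X H])
    have 1: "field_deriv (X i) (\<lambda>x. H x * H x) = (\<lambda>x. H x * field_deriv (X i) H x
        + field_deriv (X i) H x * H x)" for i
      by (rule ext) (rule field_deriv_mult[OF H H])
    have "field_deriv (X i) (field_deriv (X i) (\<lambda>x. H x * H x)) x =
        2 * H x * field_deriv (X i) (field_deriv (X i) H) x + 2 * (field_deriv (X i) H x)\<^sup>2" for i
    proof -
      have "field_deriv (X i) (\<lambda>x. H x * H x) = (\<lambda>x. 2 * (H x * field_deriv (X i) H x))"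
          unfolding 1 by auto
      then have "field_deriv (X i) (field_deriv (X i) (\<lambda>x. H x * H x)) x
          = field_deriv (X i) (\<lambda>x. 2 * (H x * field_deriv (X i) H x)) x"
        by simp
      also have "\<dots> = 2 * field_deriv (X i) (\<lambda>x. H x * field_deriv (X i) H x) x"
        by (subst field_deriv_mult[OF smooth_const smooth_mult[OF H sX]]) (simp add: field_deriv_const)
      also have "\<dots> = 2 * (H x * field_deriv (X i) (field_deriv (X i) H) x
          + field_deriv (X i) H x * field_deriv (X i) H x)"
        by (simp add: field_deriv_mult[OF H sX])
      finally show ?thesis by (simp add: power2_eq_square algebra_simps)
    qed
    then have "(\<Sum>i\<in>UNIV. field_deriv (X i) (field_deriv (X i) (\<lambda>x. H x * H x)) x) =
        2 * H x * (\<Sum>i\<in>UNIV. field_deriv (X i) (field_deriv (X i) H) x)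
            + 2 * (\<Sum>i\<in>UNIV. (field_deriv (X i) H x)\<^sup>2)"
      by (simp add: sum.distrib sum_distrib_left)
    then show ?thesis
      by (simp add: L_def field_deriv_mult[OF H H] right_diff_distrib)
  qed
  have L_sum: "L (\<lambda>x. \<Sum>k\<in>UNIV. H k x) x = (\<Sum>k\<in>UNIV. L (H k) x)"
    if H: "\<And>k. smooth (H k)" for H :: "'k \<Rightarrow> 'a \<Rightarrow> real"
  proof -
    have "field_deriv (X i) (\<lambda>x. \<Sum>k\<in>UNIV. H k x) = (\<lambda>x. \<Sum>k\<in>UNIV. field_deriv (X i) (H k) x)" for i
      by (rule ext) (rule field_deriv_sum[OF H])
    then have "field_deriv (X i) (field_deriv (X i) (\<lambda>x. \<Sum>k\<in>UNIV. H k x)) x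
        = (\<Sum>k\<in>UNIV. field_deriv (X i) (field_deriv (X i) (H k)) x)" for i
      by (simp add: field_deriv_sum[OF smooth_field_deriv[OF X H]])
    then have "(\<Sum>i\<in>UNIV. field_deriv (X i) (field_deriv (X i) (\<lambda>x. \<Sum>k\<in>UNIV. H k x)) x) =
        (\<Sum>k\<in>UNIV. \<Sum>i\<in>UNIV. field_deriv (X i) (field_deriv (X i) (H k)) x)"
      by simp (rule sum.swap)
    then show ?thesis by (simp add: L_def field_deriv_sum[OF H] sum_subtractf)
  qed
  have "L (gradient_form (\<lambda>k. field_deriv (Y k)) F F) x
      = (\<Sum>k\<in>UNIV. L (\<lambda>x. field_deriv (Y k) F x * field_deriv (Y k) F x) x)"
    using L_sum[of "\<lambda>k x. field_deriv (Y k) F x * field_deriv (Y k) F x"] smooth_mult[OF sY sY]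
    by (simp add: gradient_form_def[abs_def])
  also have "\<dots> = 2 * (\<Sum>k\<in>UNIV. field_deriv (Y k) F x * L (field_deriv (Y k) F) x) +
      2 * (\<Sum>k\<in>UNIV. \<Sum>i\<in>UNIV. (field_deriv (X i) (field_deriv (Y k) F) x)\<^sup>2)"
    by (simp add: L_square[OF sY] sum.distrib sum_distrib_left mult.assoc)
  finally show ?thesis
    by (simp add: iterated_form_def gradient_form_def right_diff_distrib sum_subtractf)
qed

section \<open>Inequalities for quadratic forms\<close>

text \<open>By homogeneity it suffices to compare on the unit sphere. Its compactness makes the supremum
  and the infimum bounds, for those of an unbounded set of reals are unspecified.\<close>
lemma bounded_quadratic_form_on_sphere:
  fixes a :: "'a::finite \<Rightarrow> 'b::finite \<Rightarrow> real^'n"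
  defines "q \<equiv> \<lambda>x. \<Sum>i\<in>UNIV. \<Sum>j\<in>UNIV. (a i j \<bullet> x)\<^sup>2"
  shows "q x \<le> (SUP y\<in>{y. norm y = 1}. q y) * (norm x)\<^sup>2"
    and "(INF y\<in>{y. norm y = 1}. q y) * (norm x)\<^sup>2 \<le> q x"
proof -
  have sph: "{y::real^'n. norm y = 1} = sphere 0 1" by auto
  have "compact (q ` sphere 0 1)"
    unfolding q_def by (intro compact_continuous_image continuous_intros) auto
  then have "bounded (q ` {y. norm y = 1})" unfolding sph by (rule compact_imp_bounded)
  then have bdd: "bdd_above (q ` {y. norm y = 1})" "bdd_below (q ` {y. norm y = 1})"
    by (auto intro: bounded_imp_bdd_above bounded_imp_bdd_below)
  have scale: "q x = q (x /\<^sub>R norm x) * (norm x)\<^sup>2 \<and> norm (x /\<^sub>R norm x) = 1" if "x \<noteq> 0"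
    using that by (simp add: q_def power_mult_distrib field_simps flip: sum_divide_distrib)
  have zero: "q 0 = 0" by (simp add: q_def)
  show "q x \<le> (SUP y\<in>{y. norm y = 1}. q y) * (norm x)\<^sup>2"
  proof (cases "x = 0")
    case False
    then have "q (x /\<^sub>R norm x) \<le> (SUP y\<in>{y. norm y = 1}. q y)"
      using scale by (intro cSUP_upper bdd) simp
    then show ?thesis using scale[OF False] by (metis mult_right_mono zero_le_power2)
  qed (simp add: zero)
  show "(INF y\<in>{y. norm y = 1}. q y) * (norm x)\<^sup>2 \<le> q x"
  proof (cases "x = 0")
    case False
    then have "(INF y\<in>{y. norm y = 1}. q y) \<le> q (x /\<^sub>R norm x)"
      using scale by (intro cINF_lower bdd) simp
    then show ?thesis using scale[OF False] by (metis mult_right_mono zero_le_power2)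
  qed (simp add: zero)
qed

lemma norm_vec_lambda_square: "(norm (\<chi> i. x i :: real^'n))\<^sup>2 = (\<Sum>i\<in>UNIV. (x i)\<^sup>2)"
  unfolding power2_norm_eq_inner by (simp add: inner_vec_def power2_eq_square)

lemma kappa_bound:
  fixes \<gamma> :: "'n::finite \<Rightarrow> 'n \<Rightarrow> 'm::finite \<Rightarrow> real"
  shows "(\<Sum>j\<in>UNIV. \<Sum>k\<in>UNIV. (\<Sum>i\<in>UNIV. \<gamma> i j k * x i)\<^sup>2) \<le> kappa \<gamma> * (\<Sum>i\<in>UNIV. (x i)\<^sup>2)"
  using bounded_quadratic_form_on_sphere(1)[of "\<lambda>j k. \<chi> i. \<gamma> i j k" "\<chi> i. x i"]
  by (simp add: kappa_def norm_vec_lambda_square inner_vec_def)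

lemma rho2_bound:
  fixes \<gamma> :: "'n::finite \<Rightarrow> 'n \<Rightarrow> 'm::finite \<Rightarrow> real"
  shows "rho2 \<gamma> * (\<Sum>k\<in>UNIV. (z k)\<^sup>2) \<le> 1/4 * (\<Sum>i\<in>UNIV. \<Sum>j\<in>UNIV. (\<Sum>k\<in>UNIV. \<gamma> i j k * z k)\<^sup>2)"
  using bounded_quadratic_form_on_sphere(2)[of "\<lambda>i j. \<chi> k. \<gamma> i j k" "\<chi> k. z k"]
  by (simp add: rho2_def norm_vec_lambda_square inner_vec_def)

text \<open>A matrix is at least as long as its antisymmetric part, whose entries are
  \<open>(a i j - a j i) / 2\<close>.\<close>
lemma sum_squares_ge_antisymmetric_part:
  fixes a :: "'n::finite \<Rightarrow> 'n \<Rightarrow> real"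
  shows "1/4 * (\<Sum>i\<in>UNIV. \<Sum>j\<in>UNIV. (a i j - a j i)\<^sup>2) \<le> (\<Sum>i\<in>UNIV. \<Sum>j\<in>UNIV. (a j i)\<^sup>2)"
proof -
  have "(a i j - a j i)\<^sup>2 \<le> 2 * (a i j)\<^sup>2 + 2 * (a j i)\<^sup>2" for i j
    using zero_le_power2[of "a i j + a j i"] by (simp add: power2_eq_square algebra_simps)
  then have "(\<Sum>i\<in>UNIV. \<Sum>j\<in>UNIV. (a i j - a j i)\<^sup>2) \<le>
      (\<Sum>i\<in>UNIV. \<Sum>j\<in>UNIV. 2 * (a i j)\<^sup>2 + 2 * (a j i)\<^sup>2)"
    by (intro sum_mono)
  also have "\<dots> = 2 * (\<Sum>i\<in>UNIV. \<Sum>j\<in>UNIV. (a i j)\<^sup>2) + 2 * (\<Sum>i\<in>UNIV. \<Sum>j\<in>UNIV. (a j i)\<^sup>2)"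
    by (simp add: sum.distrib sum_distrib_left)
  also have "(\<Sum>i\<in>UNIV. \<Sum>j\<in>UNIV. (a i j)\<^sup>2) = (\<Sum>i\<in>UNIV. \<Sum>j\<in>UNIV. (a j i)\<^sup>2)"
    by (rule sum.swap)
  finally show ?thesis by simp
qed

text \<open>Completing the square \<open>(s + \<epsilon> c)\<^sup>2 / \<epsilon> \<ge> 0\<close>.\<close>
lemma cross_term_bound:
  fixes c s \<epsilon> :: real
  assumes "\<epsilon> > 0"
  shows "2 * (s * c) + \<epsilon> * c\<^sup>2 \<ge> - (s\<^sup>2 / \<epsilon>)"
proof -
  have "0 \<le> (s + \<epsilon> * c)\<^sup>2 / \<epsilon>" using assms by simp
  also have "\<dots> = s\<^sup>2 / \<epsilon> + 2 * (s * c) + \<epsilon> * c\<^sup>2"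
    using assms by (simp add: power2_eq_square field_simps)
  finally show ?thesis by simp
qed

section \<open>Left-invariant fields and dilations on the Lie algebra\<close>

text \<open>The group is identified with its Lie algebra by the exponential map: the operators
  act on functions \<open>F\<close> on the Lie algebra, to be thought of as \<open>f \<circ> Exp\<close>.\<close>
locale carnot_frame =
  fixes G :: "('p, 'q) monoid_scheme" and Exp :: "'g::euclidean_space \<Rightarrow> 'p"
    and br :: "'g \<Rightarrow> 'g \<Rightarrow> 'g" and V1 V2 :: "'g set"
    and e :: "'n::finite \<Rightarrow> 'g" and u :: "'m::finite \<Rightarrow> 'g"
  assumes carnot: "carnot_group_step_two G Exp br V1 V2"
    and e_basis: "orthonormal_basis e V1" and u_basis: "orthonormal_basis u V2"
begin

lemma stratification: "step_two_stratification br V1 V2"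
  and bracket_bilinear: "bilinear br" and bracket_self: "br v v = 0"
  and Exp_bij: "bij_betw Exp UNIV (carrier G)"
  using carnot by (auto simp: carnot_group_step_two_def lie_bracket_def)

lemma bracket_linear_left: "linear (\<lambda>v. br v w)"
  using bracket_bilinear by (simp add: bilinear_def)

lemmas bracket_algebra = bilinear_ladd[OF bracket_bilinear] bilinear_radd[OF bracket_bilinear]
  bilinear_lmul[OF bracket_bilinear] bilinear_rmul[OF bracket_bilinear]
  bilinear_lneg[OF bracket_bilinear] bilinear_rneg[OF bracket_bilinear]

lemmas bracket_vertical = bracket_expansions(2)[OF carnot e_basis u_basis]
  bracket_expansions(3)[OF carnot e_basis u_basis]

lemma bracket_antisym: "br v w = - br w v"
  using bracket_self[of "v + w"] bracket_self[of v] bracket_self[of w]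
  by (simp add: bracket_algebra add_eq_0_iff)

lemma V1_span: "V1 = span (range e)" and V2_span: "V2 = span (range u)"
  using e_basis u_basis by (auto simp: orthonormal_basis_def)

lemma bracket_in_V2: "br v w \<in> V2"
proof -
  have S: "{v + w |v w. v \<in> V1 \<and> w \<in> V2} = UNIV"
    "span {br v w |v w. v \<in> V1 \<and> w \<in> V1} = V2"
    using stratification unfolding step_two_stratification_def by iprover+
  obtain a b where v: "v = a + b" "a \<in> V1" "b \<in> V2" using S(1) by blast
  obtain c d where w: "w = c + d" "c \<in> V1" "d \<in> V2" using S(1) by blast
  have "br v w = br a c" using v(3) w(3) by (simp add: v(1) w(1) bracket_algebra bracket_vertical)
  also have "\<dots> \<in> span {br v w |v w. v \<in> V1 \<and> w \<in> V1}" using v(2) w(2) by (intro span_base) blast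
  finally show ?thesis unfolding S(2) .
qed

lemma bracket_two_step: "br (br v w) x = 0" "br x (br v w) = 0"
  by (simp_all add: bracket_vertical bracket_in_V2)

text \<open>Evaluating the expansion of a bracket at the coordinate vector of \<open>e j\<close>.\<close>
lemma bracket_frame:
  "br (e i) (e j) = (\<Sum>k\<in>UNIV. structure_constant br e u i j k *\<^sub>R u k)"
  using bracket_expansions(1)[OF carnot e_basis u_basis, of "\<lambda>l. if l = j then 1 else 0" i]
  by (simp add: bracket_antisym[of "e i" "e j"] if_distrib[of "\<lambda>x. x *\<^sub>R _"]
      if_distrib[of "(*) _"] cong: if_cong)

lemma structure_constant_antisym: "structure_constant br e u i j k = - structure_constant br e u j i k"
  unfolding structure_constant_def using bracket_antisym[of "e i" "e j"] by simp

text \<open>The projection onto \<open>V2\<close> along \<open>V1\<close>.\<close>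
definition vert :: "'g \<Rightarrow> 'g" where
  "vert w = (\<Sum>k\<in>UNIV. representation (range e \<union> range u) w (u k) *\<^sub>R u k)"

lemma vert_linear: "linear vert"
  unfolding vert_def
  using adapted_basis[OF stratification e_basis u_basis]
  by (intro linear_sum linearI) (auto simp: representation_add representation_scale
      scaleR_add_left scaleR_sum_right sum.distrib)

lemma vert_in_V2: "vert w \<in> V2"
  unfolding vert_def V2_span by (intro span_sum span_scale span_base rangeI)

lemma vert_V1: "v \<in> V1 \<Longrightarrow> vert v = 0"
proof -
  note B = adapted_basis[OF stratification e_basis u_basis]
  have "vert (e i) = 0" for i
    unfolding vert_def using B(5)
    by (intro sum.neutral ballI) (auto simp: representation_basis[OF B(1)])
  then show "vert v = 0" if "v \<in> V1"
    using linear_eq_on_span[OF vert_linear linear_zero, of "range e" v] that unfolding V1_span by auto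
qed

lemma vert_V2: "v \<in> V2 \<Longrightarrow> vert v = v"
proof -
  note B = adapted_basis[OF stratification e_basis u_basis]
  have "representation (range e \<union> range u) (u k) (u l) *\<^sub>R u l = (if l = k then u k else 0)" for k l
    using B(4) by (auto simp: representation_basis[OF B(1)] inj_eq)
  then have "vert (u k) = u k" for k
    unfolding vert_def by simp
  then show "vert v = v" if "v \<in> V2"
    using linear_eq_on_span[OF vert_linear linear_ident, of "range u" v] that unfolding V2_span by auto
qed

text \<open>The generator of the dilations as a vector field: it doubles the \<open>V2\<close> component and keeps the
  \<open>V1\<close> component.\<close>
definition dil :: "'g \<Rightarrow> 'g" where "dil w = w + vert w"

lemma dil_linear: "linear dil"
  unfolding dil_def by (intro linear_compose_add linear_ident vert_linear)

lemma dil_frame: "dil (e i) = e i" "dil (u k) = 2 *\<^sub>R u k"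
proof -
  have "e i \<in> V1" "u k \<in> V2" unfolding V1_span V2_span by (simp_all add: span_base)
  then show "dil (e i) = e i" "dil (u k) = 2 *\<^sub>R u k"
    by (simp_all add: dil_def vert_V1 vert_V2 scaleR_2)
qed

text \<open>The velocity at \<open>t = 0\<close> of \<open>w \<cdot> t v\<close> under the group law
  \<open>w \<cdot> v = w + v + (1/2) br w v\<close>.\<close>
definition inv_vec :: "'g \<Rightarrow> 'g \<Rightarrow> 'g" where "inv_vec v w = v + (1/2) *\<^sub>R br w v"

abbreviation W :: "'g \<Rightarrow> ('g \<Rightarrow> real) \<Rightarrow> 'g \<Rightarrow> real" where "W v \<equiv> field_deriv (inv_vec v)"

lemma inv_vec_has_derivative: "(inv_vec v has_derivative (\<lambda>c. (1/2) *\<^sub>R br c v)) (at w)"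
proof -
  have "bounded_linear (\<lambda>w. br w v)"
    by (simp add: bracket_linear_left flip: linear_conv_bounded_linear)
  then have "((\<lambda>w. br w v) has_derivative (\<lambda>w. br w v)) (at w)"
    by (rule bounded_linear_imp_has_derivative)
  then show ?thesis unfolding inv_vec_def[abs_def]
    by (auto intro!: derivative_eq_intros)
qed

lemma inv_vec_smooth: "smooth (inv_vec v)"
  unfolding inv_vec_def[abs_def]
  by (intro smooth_add smooth_const smooth_linear linear_compose_scale_right bracket_linear_left)

lemma inv_vec_derivative: "frechet_derivative (inv_vec v) (at w) c = (1/2) *\<^sub>R br c v"
  using frechet_derivative_at[OF inv_vec_has_derivative] by simp

lemma dil_smooth: "smooth dil" by (rule smooth_linear[OF dil_linear])

lemma dil_derivative: "frechet_derivative dil (at w) = dil"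
  using frechet_derivative_at[OF linear_imp_has_derivative[OF dil_linear]] by simp

text \<open>The Lie algebra is represented by the left-invariant operators. The field of \<open>br v v'\<close> is
  constant, because in step two a bracket annihilates every vector.\<close>
lemma W_commutator:
  assumes "smooth F"
  shows "W v (W v' F) x - W v' (W v F) x = W (br v v') F x"
proof -
  have "(1/2) *\<^sub>R br (inv_vec v x) v' - (1/2) *\<^sub>R br (inv_vec v' x) v = inv_vec (br v v') x" for x
    by (simp add: inv_vec_def bracket_algebra bracket_two_step bracket_antisym[of v' v]
       flip: scaleR_add_left)
  then show ?thesis
    unfolding field_deriv_commutator[OF inv_vec_smooth inv_vec_smooth assms]
    by (simp add: inv_vec_derivative field_deriv_def)
qed

text \<open>This is the homogeneity of the left-invariant operators: of degree 1 on \<open>V1\<close>, where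
  \<open>dil v = v\<close>, and of degree 2 on \<open>V2\<close>, where \<open>dil v = 2 v\<close>. The linear map \<open>dil\<close> treats both at
  once.\<close>
lemma W_dil_commutator:
  assumes "smooth F"
  shows "field_deriv dil (W v F) x - W v (field_deriv dil F) x = - W (dil v) F x"
proof -
  interpret l: Real_Vector_Spaces.linear "frechet_derivative F (at x)"
    by (rule has_derivative_linear[OF smooth_has_derivative[OF assms]])
  interpret d: Real_Vector_Spaces.linear dil by (rule dil_linear)
  have dil_br: "dil (br x v) = 2 *\<^sub>R br x v"
    by (simp add: dil_def vert_V2 bracket_in_V2 scaleR_2)
  have half: "(1/2) *\<^sub>R y - y = - ((1/2) *\<^sub>R y)" for y :: 'g
    using scaleR_left_diff_distrib[of "1/2" 1 y] by simp
  have "(1/2) *\<^sub>R br (dil x) v - dil (inv_vec v x) = - inv_vec (dil v) x"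
    by (simp add: inv_vec_def d.add d.scale dil_br)
       (simp add: dil_def bracket_algebra bracket_vertical vert_in_V2 half)
  then show ?thesis
    unfolding field_deriv_commutator[OF dil_smooth inv_vec_smooth assms]
    by (simp add: inv_vec_derivative dil_derivative field_deriv_def l.neg)
qed

lemma W_sum:
  assumes "smooth F"
  shows "W (\<Sum>k\<in>I. c k *\<^sub>R v k) F x = (\<Sum>k\<in>I. c k * W (v k) F x)"
proof -
  interpret l: Real_Vector_Spaces.linear "frechet_derivative F (at x)"
    by (rule has_derivative_linear[OF smooth_has_derivative[OF assms]])
  interpret b: Real_Vector_Spaces.linear "br x" using bracket_bilinear by (simp add: bilinear_def)
  have "inv_vec (\<Sum>k\<in>I. c k *\<^sub>R v k) x = (\<Sum>k\<in>I. c k *\<^sub>R inv_vec (v k) x)"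
    by (simp add: inv_vec_def b.sum b.scale scaleR_sum_right scaleR_add_right sum.distrib mult.commute)
  then show ?thesis by (simp add: field_deriv_def l.sum l.scale)
qed

lemma W_zero: "smooth F \<Longrightarrow> W 0 F x = 0"
  using W_sum[of F _ _ "{}"] by simp

section \<open>The curvature-dimension inequality\<close>

definition L where
  "L H x = (\<Sum>j\<in>UNIV. W (e j) (W (e j) H) x) - field_deriv dil H x"

text \<open>Passing \<open>W v\<close> through the two factors of each square \<open>W (e j) \<circ> W (e j)\<close> produces
  \<open>W (br (e j) v)\<close> twice. This operator is central, so that both terms can be written with
  \<open>W (e j)\<close> in front.\<close>
lemma L_commutator:
  assumes F: "smooth F"
  shows "L (W v F) x - W v (L F) x = 2 * (\<Sum>j\<in>UNIV. W (e j) (W (br (e j) v) F) x) + W (dil v) F x"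
proof -
  have sW: "smooth (W v F)" if "smooth F" for v F by (rule smooth_field_deriv[OF inv_vec_smooth that])
  note sF = sW[OF F]
  have each: "W (e j) (W (e j) (W v F)) x = W v (W (e j) (W (e j) F)) x
      + 2 * W (e j) (W (br (e j) v) F) x" for j
  proof -
    have "W (e j) (W v F) = (\<lambda>x. W v (W (e j) F) x + W (br (e j) v) F x)"
      using W_commutator[OF F, of "e j" v] by (auto simp: fun_eq_iff algebra_simps)
    then have "W (e j) (W (e j) (W v F)) x = W (e j) (W v (W (e j) F)) x
        + W (e j) (W (br (e j) v) F) x"
      by (simp add: field_deriv_add sW F)
    moreover have "W (e j) (W v (W (e j) F)) x = W v (W (e j) (W (e j) F)) x
        + W (br (e j) v) (W (e j) F) x"
      using W_commutator[OF sF, of "e j" v "e j" x] by simp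
    moreover have "W (br (e j) v) (W (e j) F) x = W (e j) (W (br (e j) v) F) x"
      using W_commutator[OF F, of "br (e j) v" "e j" x] by (simp add: bracket_two_step W_zero[OF F])
    ultimately show ?thesis by simp
  qed
  have "W v (L F) x = (\<Sum>j\<in>UNIV. W v (W (e j) (W (e j) F)) x) - W v (field_deriv dil F) x"
    unfolding L_def[abs_def]
    by (simp add: field_deriv_diff field_deriv_sum sW F smooth_sum smooth_field_deriv[OF dil_smooth])
  then show ?thesis
    using W_dil_commutator[OF F, of v x]
    by (simp add: L_def each sum.distrib sum_distrib_left)
qed

text \<open>The bracket of \<open>e j\<close> and \<open>e i\<close> lies in \<open>V2\<close>, so that the commutator with the sub-Laplacian
  contributes mixed derivatives \<open>X j (Z k F)\<close>, and homogeneity of degree 1 contributes the last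
  summand.\<close>
lemma iterated_form_horizontal:
  assumes F: "smooth F"
  shows "iterated_form L (gradient_form (\<lambda>i. W (e i))) F x =
    (\<Sum>i\<in>UNIV. \<Sum>j\<in>UNIV. (W (e j) (W (e i) F) x)\<^sup>2) +
    2 * (\<Sum>i\<in>UNIV. \<Sum>j\<in>UNIV. \<Sum>k\<in>UNIV.
      W (e i) F x * structure_constant br e u j i k * W (e j) (W (u k) F) x) +
    gradient_form (\<lambda>i. W (e i)) F F x"
proof -
  have sW: "smooth (W v F)" for v by (rule smooth_field_deriv[OF inv_vec_smooth F])
  have "W (e j) (W (br (e j) (e i)) F) x =
      (\<Sum>k\<in>UNIV. structure_constant br e u j i k * W (e j) (W (u k) F) x)" for i j
  proof -
    have "W (br (e j) (e i)) F = (\<lambda>x. \<Sum>k\<in>UNIV. structure_constant br e u j i k * W (u k) F x)"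
      by (auto simp: bracket_frame W_sum[OF F])
    then show ?thesis by (simp add: field_deriv_sum field_deriv_mult field_deriv_const sW
        smooth_const smooth_mult)
  qed
  then have "W (e i) F x * (L (W (e i) F) x - W (e i) (L F) x) =
      2 * (\<Sum>j\<in>UNIV. \<Sum>k\<in>UNIV.
        W (e i) F x * structure_constant br e u j i k * W (e j) (W (u k) F) x) +
      W (e i) F x * W (e i) F x" for i
    unfolding L_commutator[OF F] by (simp add: dil_frame distrib_left sum_distrib_left mult_ac)
  then show ?thesis
    using iterated_gradient_form[OF inv_vec_smooth inv_vec_smooth dil_smooth F,
        of "\<lambda>i. e i" "\<lambda>i. e i" x]
    by (simp add: L_def[abs_def] gradient_form_def sum.distrib sum_distrib_left)
qed

text \<open>Vertical operators commute with the sub-Laplacian, so that only their homogeneity of degree 2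
  contributes besides the squares.\<close>
lemma iterated_form_vertical:
  assumes F: "smooth F"
  shows "iterated_form L (gradient_form (\<lambda>k. W (u k))) F x =
    (\<Sum>k\<in>UNIV. \<Sum>j\<in>UNIV. (W (e j) (W (u k) F) x)\<^sup>2) + 2 * gradient_form (\<lambda>k. W (u k)) F F x"
proof -
  have W0: "W 0 F = (\<lambda>x. 0)" using W_zero[OF F] by auto
  have "u k \<in> V2" for k by (simp add: V2_span span_base)
  then have "br (e j) (u k) = 0" for j k by (simp add: bracket_vertical)
  then have "L (W (u k) F) x - W (u k) (L F) x = 2 * W (u k) F x" for k
    using W_sum[OF F, of "\<lambda>_. 2" "\<lambda>_. u k" "{k}" x]
    by (simp add: L_commutator[OF F] dil_frame W0 field_deriv_const)
  then show ?thesis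
    using iterated_gradient_form[OF inv_vec_smooth inv_vec_smooth dil_smooth F,
        of "\<lambda>i. e i" "\<lambda>k. u k" x]
    by (simp add: L_def[abs_def] gradient_form_def sum_distrib_left mult_ac)
qed

text \<open>The antisymmetric part of the horizontal Hessian \<open>a\<close> consists of vertical derivatives and
  yields \<open>rho2\<close>. The cross terms between \<open>X i\<close> and the mixed derivatives \<open>c j k\<close> have no sign; the
  squares of the mixed derivatives in the vertical iterated form absorb them at the expense of
  \<open>kappa / \<epsilon>\<close>.\<close>
lemma curvature_dimension:
  assumes F: "smooth F" and \<epsilon>: "\<epsilon> > 0"
  defines "\<gamma> \<equiv> structure_constant br e u"
    and "\<Gamma> \<equiv> gradient_form (\<lambda>i. W (e i))" and "\<Gamma>\<^sub>Z \<equiv> gradient_form (\<lambda>k. W (u k))"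
  shows "(1 - kappa \<gamma> / \<epsilon>) * \<Gamma> F F x + (2 * \<epsilon> + rho2 \<gamma>) * \<Gamma>\<^sub>Z F F x
    \<le> iterated_form L \<Gamma> F x + \<epsilon> * iterated_form L \<Gamma>\<^sub>Z F x"
proof -
  define a where "a j i = W (e j) (W (e i) F) x" for i j
  define c where "c j k = W (e j) (W (u k) F) x" for j k
  define X where "X i = W (e i) F x" for i
  define Z where "Z k = W (u k) F x" for k
  define s where "s j k = (\<Sum>i\<in>UNIV. X i * \<gamma> j i k)" for j k
  have \<Gamma>: "\<Gamma> F F x = (\<Sum>i\<in>UNIV. (X i)\<^sup>2)" and \<Gamma>Z: "\<Gamma>\<^sub>Z F F x = (\<Sum>k\<in>UNIV. (Z k)\<^sup>2)"
    by (simp_all add: \<Gamma>_def \<Gamma>\<^sub>Z_def gradient_form_def X_def Z_def power2_eq_square)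
  have "a i j - a j i = (\<Sum>k\<in>UNIV. \<gamma> i j k * Z k)" for i j
    by (simp add: a_def W_commutator[OF F] bracket_frame W_sum[OF F] Z_def \<gamma>_def)
  then have hess: "rho2 \<gamma> * (\<Sum>k\<in>UNIV. (Z k)\<^sup>2) \<le> (\<Sum>i\<in>UNIV. \<Sum>j\<in>UNIV. (a j i)\<^sup>2)"
    using rho2_bound[of \<gamma> Z] sum_squares_ge_antisymmetric_part[of a] by simp
  have "s j k = - (\<Sum>i\<in>UNIV. \<gamma> i j k * X i)" for j k
    unfolding s_def \<gamma>_def
    by (subst structure_constant_antisym) (simp add: sum_negf mult.commute)
  then have "(\<Sum>j\<in>UNIV. \<Sum>k\<in>UNIV. (s j k)\<^sup>2) \<le> kappa \<gamma> * (\<Sum>i\<in>UNIV. (X i)\<^sup>2)"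
    using kappa_bound[of \<gamma> X] by simp
  then have "- (kappa \<gamma> / \<epsilon> * (\<Sum>i\<in>UNIV. (X i)\<^sup>2)) \<le> - ((\<Sum>j\<in>UNIV. \<Sum>k\<in>UNIV. (s j k)\<^sup>2) / \<epsilon>)"
    using \<epsilon> by (simp add: divide_right_mono)
  also have "\<dots> = (\<Sum>j\<in>UNIV. \<Sum>k\<in>UNIV. - ((s j k)\<^sup>2 / \<epsilon>))"
    by (simp add: sum_divide_distrib sum_negf)
  also have "\<dots> \<le> (\<Sum>j\<in>UNIV. \<Sum>k\<in>UNIV. 2 * (s j k * c j k) + \<epsilon> * (c j k)\<^sup>2)"
    by (intro sum_mono cross_term_bound[OF \<epsilon>])
  also have "\<dots> = 2 * (\<Sum>j\<in>UNIV. \<Sum>k\<in>UNIV. s j k * c j k) + \<epsilon> * (\<Sum>j\<in>UNIV. \<Sum>k\<in>UNIV. (c j k)\<^sup>2)"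
    by (simp add: sum.distrib sum_distrib_left)
  also have "(\<Sum>j\<in>UNIV. \<Sum>k\<in>UNIV. (c j k)\<^sup>2) = (\<Sum>k\<in>UNIV. \<Sum>j\<in>UNIV. (c j k)\<^sup>2)"
    by (rule sum.swap)
  also have "(\<Sum>j\<in>UNIV. \<Sum>k\<in>UNIV. s j k * c j k) =
      (\<Sum>j\<in>UNIV. \<Sum>i\<in>UNIV. \<Sum>k\<in>UNIV. X i * \<gamma> j i k * c j k)"
    unfolding s_def sum_distrib_right by (intro sum.cong refl sum.swap)
  also have "\<dots> = (\<Sum>i\<in>UNIV. \<Sum>j\<in>UNIV. \<Sum>k\<in>UNIV. X i * \<gamma> j i k * c j k)"
    by (rule sum.swap)
  finally have cross: "- (kappa \<gamma> / \<epsilon> * (\<Sum>i\<in>UNIV. (X i)\<^sup>2)) \<le>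
      2 * (\<Sum>i\<in>UNIV. \<Sum>j\<in>UNIV. \<Sum>k\<in>UNIV. X i * \<gamma> j i k * c j k) +
      \<epsilon> * (\<Sum>k\<in>UNIV. \<Sum>j\<in>UNIV. (c j k)\<^sup>2)" .
  have "iterated_form L \<Gamma> F x + \<epsilon> * iterated_form L \<Gamma>\<^sub>Z F x =
      (\<Sum>i\<in>UNIV. \<Sum>j\<in>UNIV. (a j i)\<^sup>2) +
      2 * (\<Sum>i\<in>UNIV. \<Sum>j\<in>UNIV. \<Sum>k\<in>UNIV. X i * \<gamma> j i k * c j k) + \<Gamma> F F x +
      \<epsilon> * (\<Sum>k\<in>UNIV. \<Sum>j\<in>UNIV. (c j k)\<^sup>2) + 2 * \<epsilon> * \<Gamma>\<^sub>Z F F x"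
    unfolding \<Gamma>_def \<Gamma>\<^sub>Z_def iterated_form_horizontal[OF F] iterated_form_vertical[OF F]
    by (simp add: a_def c_def X_def \<gamma>_def distrib_left)
  with hess cross show ?thesis unfolding \<Gamma> \<Gamma>Z by (simp add: distrib_right left_diff_distrib)
qed

section \<open>Transfer from the Lie algebra to the group\<close>

lemma left_inv_field_pullback:
  assumes "smooth_fun Exp h"
  shows "left_inv_field G Exp v h (Exp w) = W v (\<lambda>w. h (Exp w)) w"
  by (simp add: left_inv_field_Exp[OF carnot assms] field_deriv_def inv_vec_def)

text \<open>With \<open>w = hor + vert w\<close>, the coordinates of \<open>w\<close> combine the left-invariant fields to
  \<open>hor + (1/2) br w hor + 2 vert w\<close>, and the bracket vanishes because \<open>br hor hor = 0\<close>.\<close>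
lemma dilation_field_pullback:
  assumes h: "smooth_fun Exp h"
  shows "dilation_field G Exp e u h (Exp w) = field_deriv dil (\<lambda>w. h (Exp w)) w"
proof -
  let ?x = "\<lambda>i. exp_coord Exp e u (e i) (Exp w)" and ?z = "\<lambda>k. exp_coord Exp e u (u k) (Exp w)"
  define hor where "hor = (\<Sum>i\<in>UNIV. ?x i *\<^sub>R e i)"
  have F: "smooth (\<lambda>w. h (Exp w))" using h by (simp add: smooth_fun_def)
  interpret l: Real_Vector_Spaces.linear "frechet_derivative (\<lambda>w. h (Exp w)) (at w)"
    by (rule has_derivative_linear[OF smooth_has_derivative[OF F]])
  have inv: "inv_into UNIV Exp (Exp w) = w"
    using Exp_bij by (simp add: bij_betw_def)
  have ver: "vert w = (\<Sum>k\<in>UNIV. ?z k *\<^sub>R u k)"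
    by (simp add: vert_def exp_coord_def inv)
  have w: "w = hor + vert w"
    using exp_coord_expansion[OF stratification e_basis u_basis, of Exp "Exp w"]
    by (simp add: inv hor_def ver)
  have "br w hor = br (hor + vert w) hor" by (subst w) simp
  then have 0: "br w hor = 0"
    by (simp add: bracket_algebra bracket_self bracket_vertical vert_in_V2)
  have "dilation_field G Exp e u h (Exp w) =
      W hor (\<lambda>w. h (Exp w)) w + 2 * W (vert w) (\<lambda>w. h (Exp w)) w"
    by (simp add: dilation_field_def left_inv_field_pullback[OF h] hor_def ver W_sum[OF F])
  also have "\<dots> = frechet_derivative (\<lambda>w. h (Exp w)) (at w) (hor + vert w + vert w)"
    by (simp add: field_deriv_def inv_vec_def 0 bracket_vertical vert_in_V2 l.add)
  also have "hor + vert w + vert w = dil w" using w by (simp add: dil_def)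
  finally show ?thesis by (simp add: field_deriv_def)
qed

lemma smooth_fun_left_inv_field:
  "smooth_fun Exp h \<Longrightarrow> smooth_fun Exp (left_inv_field G Exp v h)"
  by (simp add: smooth_fun_def left_inv_field_pullback smooth_field_deriv[OF inv_vec_smooth])

lemma generator_pullback:
  assumes h: "smooth_fun Exp h"
  shows "sub_laplacian G Exp e h (Exp w) - dilation_field G Exp e u h (Exp w) =
    L (\<lambda>w. h (Exp w)) w"
  by (simp add: sub_laplacian_def L_def dilation_field_pullback[OF h] left_inv_field_pullback
      smooth_fun_left_inv_field h)

text \<open>An iterated form applies the generator to the gradient form of \<open>f\<close>, and the fields to the
  image of \<open>f\<close> under the generator. These functions are smooth again, hence the derivative in the
  definition of a left-invariant field is the one along \<open>inv_vec\<close> for them too.\<close>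
lemma iterated_form_pullback:
  fixes v :: "'i::finite \<Rightarrow> 'g"
  assumes f: "smooth_fun Exp f"
  defines "F \<equiv> \<lambda>w. f (Exp w)"
  shows "gradient_form (\<lambda>i. left_inv_field G Exp (v i)) f f (Exp w)
      = gradient_form (\<lambda>i. W (v i)) F F w"
    and "iterated_form (\<lambda>h q. sub_laplacian G Exp e h q - dilation_field G Exp e u h q)
      (gradient_form (\<lambda>i. left_inv_field G Exp (v i))) f (Exp w) =
      iterated_form L (gradient_form (\<lambda>i. W (v i))) F w"
proof -
  let ?Q = "gradient_form (\<lambda>i. left_inv_field G Exp (v i))"
  have F: "smooth F" using f by (simp add: F_def smooth_fun_def)
  have sW: "smooth (W v F)" if "smooth F" for v F by (rule smooth_field_deriv[OF inv_vec_smooth that])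
  show Q: "?Q f f (Exp w) = gradient_form (\<lambda>i. W (v i)) F F w" for w
    by (simp add: gradient_form_def left_inv_field_pullback[OF f] F_def)
  have Qf: "smooth_fun Exp (?Q f f)"
    unfolding smooth_fun_def Q unfolding gradient_form_def
    by (intro smooth_sum smooth_mult sW F)
  have Lf: "smooth_fun Exp (\<lambda>q. sub_laplacian G Exp e f q - dilation_field G Exp e u f q)"
    unfolding smooth_fun_def generator_pullback[OF f] F_def[symmetric] unfolding L_def
    by (intro smooth_sum smooth_diff sW F smooth_field_deriv dil_smooth)
  show "iterated_form (\<lambda>h q. sub_laplacian G Exp e h q - dilation_field G Exp e u h q) ?Q f (Exp w) =
      iterated_form L (gradient_form (\<lambda>i. W (v i))) F w"
    unfolding iterated_form_def generator_pullback[OF Qf] Q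
    by (simp add: gradient_form_def[abs_def] left_inv_field_pullback[OF f]
        left_inv_field_pullback[OF Lf]
        generator_pullback[OF f] F_def)
qed

end

theorem proposition2p5:
  fixes G :: "('p, 'q) monoid_scheme"
    and Exp :: "'g::euclidean_space \<Rightarrow> 'p"
    and br :: "'g \<Rightarrow> 'g \<Rightarrow> 'g"
    and V1 V2 :: "'g set"
    and e :: "'n::finite \<Rightarrow> 'g"
    and u :: "'m::finite \<Rightarrow> 'g"
    and f :: "'p \<Rightarrow> real"
    and \<epsilon> :: real
    and p :: 'p
  assumes "carnot_group_step_two G Exp br V1 V2"
    and "orthonormal_basis e V1"
    and "orthonormal_basis u V2"
    and "smooth_fun Exp f"
    and "\<epsilon> > 0"
    and "p \<in> carrier G"
  shows "let \<gamma> = structure_constant br e u;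
             X = (\<lambda>i. left_inv_field G Exp (e i));
             Z = (\<lambda>k. left_inv_field G Exp (u k));
             L = (\<lambda>h q. sub_laplacian G Exp e h q - dilation_field G Exp e u h q);
             \<Gamma> = gradient_form X;
             \<Gamma>\<^sub>Z = gradient_form Z
         in iterated_form L \<Gamma> f p + \<epsilon> * iterated_form L \<Gamma>\<^sub>Z f p
              \<ge> (1 - kappa \<gamma> / \<epsilon>) * \<Gamma> f f p + (2 * \<epsilon> + rho2 \<gamma>) * \<Gamma>\<^sub>Z f f p"
proof -
  interpret carnot_frame G Exp br V1 V2 e u
    using assms(1-3) by unfold_locales
  obtain w where p: "p = Exp w" using Exp_bij assms(6) by (auto simp: bij_betw_def)
  have "smooth (\<lambda>w. f (Exp w))" using assms(4) by (simp add: smooth_fun_def)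
  from curvature_dimension[OF this assms(5), of w] show ?thesis
    unfolding Let_def p iterated_form_pullback[OF assms(4)] .
qed

end
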